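(* Assume $\varkappa(\Omega)\le2$. A real-valued function $w$ on $\Omega$ belongs to $\mathrm{ex}\,\mathcal{S}(\Gamma,\mathcal{W})$ if and only if $G_w\cap\Omega_k\neq\varnothing$ for all $\Omega_k\in\Gamma$ (where $G_w:=\mathrm{supp}\,w$) and $w$ satisfies the following two conditions: (1) each connected component of the graph $G_w$ either (1$_1$) consists of one isolated vertex $g$, or (1$_2$) coincides with an odd primitive cycle $\gamma$ (i.e. its vertex set is the vertex set of an odd primitive cycle $\gamma$); (2) $w(g)=1$ in case (1$_1$), and $w\equiv\frac12$ on the vertices of $\gamma$ in case (1$_2$).
   Context: Let $\Gamma=\{\Omega_1,\Omega_2,\ldots\}$ be a finite or countably infinite family of countable sets (possibly intersecting), $\Omega:=\bigcup_k\Omega_k$. Standing assumptions: $\Omega_k\setminus\Omega_j\ne\varnothing$ for $j\ne k$, and each $g\in\Omega$ lies in finitely many $\Omega_k$. $\varkappa(g):=\#\{k:g\in\Omega_k\}$, $\varkappa(\Omega):=\sup_{g\in\Omega}\varkappa(g)$. $\mathcal{S}(\Gamma)$ (resp. $\mathcal{S}^0(\Gamma)$) is the set of nonnegative functions $w$ on $\Omega$ with $\sum_{g\in\Omega_k}w(g)=1$ (resp. $\le1$) for all $k$; $\mathcal{P}^0(\Gamma)$ is the set of functions in $\mathcal{S}^0(\Gamma)$ taking only the values $0,1$. $\mathcal{W}$ is a linear space of real-valued functions on $\Omega$ containing $\mathcal{P}^0(\Gamma)$ and such that $w\in\mathcal{W}$, $|\tilde w|\le|w|$ imply $\tilde w\in\mathcal{W}$.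 $\mathcal{S}(\Gamma,\mathcal{W}):=\mathcal{S}(\Gamma)\cap\mathcal{W}$; $\mathrm{ex}\,A$ is the set of extreme points of $A$. The graph $G$ has vertex set $\Omega$, two distinct vertices adjacent iff they lie in a common $\Omega_k$; subsets of $\Omega$ (e.g. $\mathrm{supp}\,w$) are regarded as induced subgraphs. A path is a sequence $(g_1,\dots,g_m)$ of vertices with $(g_j,g_{j+1})$ distinct edges; it is a cycle if $g_m=g_1$, odd if it contains an odd number of vertices. A path $\gamma$ is simple if each of its vertices is adjacent to at most two other vertices of $\gamma$; a simple path is primitive if no $\Omega_k$ contains more than two of its vertices. *)

theory Defs
  imports
    "HOL-Analysis.Analysis"
    "HOL-Library.Function_Algebras"
begin

text \<open>The pointwise vector space structure on functions, so that \<^const>\<open>subspace\<close> and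
  \<^const>\<open>extreme_point_of\<close> apply to sets of functions.\<close>

instantiation "fun" :: (type, real_vector) real_vector
begin

definition scaleR_fun :: "real \<Rightarrow> ('a \<Rightarrow> 'b) \<Rightarrow> 'a \<Rightarrow> 'b" where
  "scaleR_fun c f = (\<lambda>x. c *\<^sub>R f x)"

instance
  by standard (simp_all add: scaleR_fun_def fun_eq_iff scaleR_add_right scaleR_add_left)

end

lemma scaleR_fun_apply [simp]: "(c *\<^sub>R f) x = c *\<^sub>R f x"
  by (simp add: scaleR_fun_def)

text \<open>A family \<open>\<Gamma>\<close> is a set of sets, with ground set \<open>\<Omega> = \<Union>\<Gamma>\<close>: the assumption that no
  member is contained in another one with a different index excludes repetitions.
  A real function on \<open>\<Omega>\<close> is represented by its extension by zero to the whole type.\<close>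

definition fun_on :: "'a set \<Rightarrow> ('a \<Rightarrow> real) set" where
  "fun_on X = {w. \<forall>g. g \<notin> X \<longrightarrow> w g = 0}"

definition supp :: "('a \<Rightarrow> real) \<Rightarrow> 'a set" where
  "supp w = {g. w g \<noteq> 0}"

definition multiplicity_at :: "'a set set \<Rightarrow> 'a \<Rightarrow> nat" where
  "multiplicity_at \<Gamma> g = card {A \<in> \<Gamma>. g \<in> A}"

definition kappa :: "'a set set \<Rightarrow> enat" where
  "kappa \<Gamma> = (SUP g\<in>\<Union>\<Gamma>. enat (multiplicity_at \<Gamma> g))"

definition stochastic :: "'a set set \<Rightarrow> ('a \<Rightarrow> real) set" where
  "stochastic \<Gamma> = {w \<in> fun_on (\<Union>\<Gamma>). (\<forall>g. 0 \<le> w g) \<and> (\<forall>A\<in>\<Gamma>. (w has_sum 1) A)}"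

definition substochastic :: "'a set set \<Rightarrow> ('a \<Rightarrow> real) set" where
  "substochastic \<Gamma> = {w \<in> fun_on (\<Union>\<Gamma>). (\<forall>g. 0 \<le> w g) \<and>
     (\<forall>A\<in>\<Gamma>. w summable_on A \<and> infsum w A \<le> 1)}"

definition zero_one_substochastic :: "'a set set \<Rightarrow> ('a \<Rightarrow> real) set" where
  "zero_one_substochastic \<Gamma> = {w \<in> substochastic \<Gamma>. range w \<subseteq> {0, 1}}"

definition admissible_space :: "'a set set \<Rightarrow> ('a \<Rightarrow> real) set \<Rightarrow> bool" where
  "admissible_space \<Gamma> W \<longleftrightarrow>
     W \<subseteq> fun_on (\<Union>\<Gamma>) \<and> subspace W \<and> zero_one_substochastic \<Gamma> \<subseteq> W \<and>
     (\<forall>w\<in>W. \<forall>v\<in>fun_on (\<Union>\<Gamma>). (\<forall>g. \<bar>v g\<bar> \<le> \<bar>w g\<bar>) \<longrightarrow> v \<in> W)"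

definition ex :: "('a \<Rightarrow> real) set \<Rightarrow> ('a \<Rightarrow> real) set" where
  "ex S = {w. w extreme_point_of S}"

definition adjacent :: "'a set set \<Rightarrow> 'a \<Rightarrow> 'a \<Rightarrow> bool" where
  "adjacent \<Gamma> g h \<longleftrightarrow> g \<noteq> h \<and> (\<exists>A\<in>\<Gamma>. g \<in> A \<and> h \<in> A)"

text \<open>Vertex sets of the connected components of the subgraph induced by \<open>V\<close>.\<close>

definition graph_components :: "'a set set \<Rightarrow> 'a set \<Rightarrow> 'a set set" where
  "graph_components \<Gamma> V = V // (Restr {(x, y). adjacent \<Gamma> x y} V)\<^sup>*"

text \<open>Edges are undirected, hence represented by two-element sets.\<close>

definition path_edges :: "'a list \<Rightarrow> 'a set list" where
  "path_edges \<gamma> = map (\<lambda>j. {\<gamma> ! j, \<gamma> ! Suc j}) [0..<length \<gamma> - 1]"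

definition graph_path :: "'a set set \<Rightarrow> 'a list \<Rightarrow> bool" where
  "graph_path \<Gamma> \<gamma> \<longleftrightarrow> \<gamma> \<noteq> [] \<and> set \<gamma> \<subseteq> \<Union>\<Gamma> \<and>
     (\<forall>j. Suc j < length \<gamma> \<longrightarrow> adjacent \<Gamma> (\<gamma> ! j) (\<gamma> ! Suc j)) \<and> distinct (path_edges \<gamma>)"

text \<open>The one-term sequence \<open>[g]\<close>, which has no edge, is not regarded as a cycle.\<close>

definition graph_cycle :: "'a set set \<Rightarrow> 'a list \<Rightarrow> bool" where
  "graph_cycle \<Gamma> \<gamma> \<longleftrightarrow> graph_path \<Gamma> \<gamma> \<and> length \<gamma> > 1 \<and> last \<gamma> = hd \<gamma>"

text \<open>The vertices are counted without repetition: the closing term \<open>g\<^sub>m = g\<^sub>1\<close> of a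
  cycle is not an additional vertex, so that a triangle is odd.\<close>

definition odd_path :: "'a list \<Rightarrow> bool" where
  "odd_path \<gamma> \<longleftrightarrow> odd (card (set \<gamma>))"

definition simple_graph_path :: "'a set set \<Rightarrow> 'a list \<Rightarrow> bool" where
  "simple_graph_path \<Gamma> \<gamma> \<longleftrightarrow> graph_path \<Gamma> \<gamma> \<and>
     (\<forall>g\<in>set \<gamma>. card {h \<in> set \<gamma>. adjacent \<Gamma> g h} \<le> 2)"

definition primitive_path :: "'a set set \<Rightarrow> 'a list \<Rightarrow> bool" where
  "primitive_path \<Gamma> \<gamma> \<longleftrightarrow> simple_graph_path \<Gamma> \<gamma> \<and> (\<forall>A\<in>\<Gamma>. card (A \<inter> set \<gamma>) \<le> 2)"

definition odd_primitive_cycle :: "'a set set \<Rightarrow> 'a list \<Rightarrow> bool" where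
  "odd_primitive_cycle \<Gamma> \<gamma> \<longleftrightarrow> graph_cycle \<Gamma> \<gamma> \<and> primitive_path \<Gamma> \<gamma> \<and> odd_path \<gamma>"

end

theory Submission
  imports Defs
begin

text \<open>View \<open>\<Gamma>\<close> as a multigraph whose nodes are the members of \<open>\<Gamma>\<close> and whose edges are the points of
  \<open>supp w\<close>; since \<open>\<kappa> \<le> 2\<close>, an edge has one or two ends. A weight \<open>w\<close> is extreme iff no nonzero
  function dominated by a multiple of \<open>|w|\<close> has sum zero at every node. Hence, for each node \<open>A\<close>, a
  dominated function with sum zero at every node other than \<open>A\<close> is unique up to a factor.
  Start at \<open>A\<close> through an edge \<open>g\<close> with \<open>w g < 1\<close> and follow non-backtracking walks. If they never
  return to a visited node, the walks form a tree, and a unit of mass sent along it with alternating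
  signs, split at each node in proportion to \<open>w\<close>, yields such a function that vanishes on \<open>A\<close> except
  at \<open>g\<close>. Otherwise a walk closes up to a lollipop, and alternating signs on its cycle, doubled on
  its stick, yield one that vanishes on \<open>A\<close> except at \<open>g\<close> and, if there is no stick, at the last
  edge. Since this can be done for every edge at \<open>A\<close>, uniqueness leaves only the case of a cycle of
  odd length through \<open>A\<close> with exactly two edges at each of its nodes.
  Conversely, the values on isolated points and odd cycles are forced by the sums; such a weight lies
  in \<open>W\<close> because it is at most the sum of three 0-1 functions given by a proper 3-colouring.\<close>

section \<open>Walks between the members of the family\<close>

locale weighting =
  fixes \<Gamma> :: "'a set set" and w :: "'a \<Rightarrow> real"
  assumes nonneg: "0 \<le> w g"
    and has_sum_one: "A \<in> \<Gamma> \<Longrightarrow> (w has_sum 1) A"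
    and at_most_two: "\<lbrakk>A \<in> \<Gamma>; B \<in> \<Gamma>; C \<in> \<Gamma>; g \<in> A; g \<in> B; g \<in> C\<rbrakk> \<Longrightarrow> A = B \<or> A = C \<or> B = C"
begin

lemma pos: "g \<in> supp w \<Longrightarrow> 0 < w g"
  using nonneg[of g] by (simp add: supp_def)

lemma pair_le_one:
  assumes "A \<in> \<Gamma>" "g \<in> A" "h \<in> A" "g \<noteq> h"
  shows "w g + w h \<le> 1"
proof -
  have "(w has_sum (\<Sum>x\<in>{g, h}. w x)) {g, h}" by (rule has_sum_finite) simp
  from has_sum_mono2[OF this has_sum_one[OF assms(1)]] show ?thesis
    using assms nonneg by auto
qed

lemma ex_other:
  assumes "A \<in> \<Gamma>" "w g < 1"
  shows "\<exists>h\<in>A \<inter> supp w. h \<noteq> g"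
proof (rule ccontr)
  assume "\<not> ?thesis"
  then have *: "w h = 0" if "h \<in> A" "h \<noteq> g" for h using that by (auto simp: supp_def)
  have "(w has_sum (\<Sum>x\<in>A \<inter> {g}. w x)) A"
    by (rule has_sum_finite_neutralI) (use * in auto)
  with has_sum_one[OF assms(1)] have "(\<Sum>x\<in>A \<inter> {g}. w x) = 1" by (rule has_sum_unique[symmetric])
  with assms(2) nonneg[of g] show False by (cases "g \<in> A") auto
qed

section \<open>Functions dominated by the weight\<close>

definition dominated :: "('a \<Rightarrow> real) \<Rightarrow> bool" where
  "dominated u \<longleftrightarrow> (\<exists>c. \<forall>g. \<bar>u g\<bar> \<le> c * w g)"

lemma dominated_add: "dominated u \<Longrightarrow> dominated v \<Longrightarrow> dominated (\<lambda>x. u x + v x)"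
  unfolding dominated_def
proof (elim exE)
  fix c d assume "\<forall>g. \<bar>u g\<bar> \<le> c * w g" "\<forall>g. \<bar>v g\<bar> \<le> d * w g"
  then show "\<exists>c. \<forall>g. \<bar>u g + v g\<bar> \<le> c * w g"
    by (intro exI[of _ "c + d"]) (smt (verit) distrib_right)
qed

lemma dominated_scale: "dominated u \<Longrightarrow> dominated (\<lambda>x. a * u x)"
  unfolding dominated_def
proof (elim exE)
  fix c assume "\<forall>g. \<bar>u g\<bar> \<le> c * w g"
  then show "\<exists>c. \<forall>g. \<bar>a * u g\<bar> \<le> c * w g"
    by (intro exI[of _ "\<bar>a\<bar> * c"]) (auto simp: abs_mult mult.assoc intro!: mult_left_mono)
qed

lemma dominated_single:
  assumes "g \<in> supp w"
  shows "dominated (\<lambda>x. if x = g then a else 0)"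
  unfolding dominated_def
proof (intro exI[of _ "\<bar>a\<bar> / w g"] allI)
  fix x show "\<bar>if x = g then a else 0\<bar> \<le> \<bar>a\<bar> / w g * w x"
    using pos[OF assms] nonneg[of x] by auto
qed

lemma dominated_summable:
  assumes "dominated u" "A \<in> \<Gamma>"
  shows "u summable_on A"
proof -
  from assms(1) obtain c where c: "\<And>g. \<bar>u g\<bar> \<le> c * w g" by (auto simp: dominated_def)
  have "(\<lambda>x. c * w x) summable_on A"
    using has_sum_one[OF assms(2)] by (intro summable_on_cmult_right) (auto simp: summable_on_def)
  then have "(\<lambda>x. norm (u x)) summable_on A"
    by (rule Infinite_Sum.abs_summable_on_comparison_test') (use c in auto)
  then show ?thesis by (rule abs_summable_summable)
qed

text \<open>A discrete analogue of a Green function with pole \<open>A\<close>: the sum at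
  \<open>A\<close> is left free, and under rigidity a nonzero function of this kind has a nonzero
  sum there.\<close>

definition balanced_off :: "'a set \<Rightarrow> ('a \<Rightarrow> real) \<Rightarrow> bool" where
  "balanced_off A u \<longleftrightarrow> dominated u \<and> (\<forall>B\<in>\<Gamma>. B \<noteq> A \<longrightarrow> (u has_sum 0) B)"

text \<open>The list \<open>[(g\<^sub>n, A\<^sub>n), \<dots>, (g\<^sub>0, A\<^sub>0)]\<close> is the non-backtracking walk that starts at \<open>A\<^sub>0\<close> and
  leaves the node \<open>A\<^sub>i\<close> through the edge \<open>g\<^sub>i\<close>; the far end of the last edge \<open>g\<^sub>n\<close> is not recorded,
  and it may fail to exist.\<close>

fun walk :: "('a \<times> 'a set) list \<Rightarrow> bool" where
  "walk [] \<longleftrightarrow> False"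
| "walk [(g, A)] \<longleftrightarrow> A \<in> \<Gamma> \<and> g \<in> A \<and> g \<in> supp w"
| "walk ((g, A) # (h, B) # P) \<longleftrightarrow>
     A \<in> \<Gamma> \<and> g \<in> A \<and> g \<in> supp w \<and> h \<in> A \<and> h \<noteq> g \<and> A \<noteq> B \<and> walk ((h, B) # P)"

lemma walk_tl: "walk (x # P) \<Longrightarrow> P \<noteq> [] \<Longrightarrow> walk P"
  by (cases x; cases P) auto

lemma walk_append: "walk (P @ Q) \<Longrightarrow> Q \<noteq> [] \<Longrightarrow> walk Q"
  by (induction P) (auto dest: walk_tl)

lemma walk_mem: "walk P \<Longrightarrow> (g, A) \<in> set P \<Longrightarrow> A \<in> \<Gamma> \<and> g \<in> A \<and> g \<in> supp w"
  by (induction P rule: walk.induct) auto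

lemma walk_head: "walk ((g, A) # P) \<Longrightarrow> A \<in> \<Gamma> \<and> g \<in> A \<and> g \<in> supp w"
  by (rule walk_mem[of "(g, A) # P"]) auto

section \<open>Alternating signs along a walk\<close>

fun alternating :: "('a \<times> 'a set) list \<Rightarrow> 'a \<Rightarrow> real" where
  "alternating [] = (\<lambda>_. 0)"
| "alternating ((g, A) # P) = (\<lambda>x. (if x = g then (-1) ^ length P else 0) + alternating P x)"

lemma dominated_alternating: "walk P \<Longrightarrow> dominated (alternating P)"
proof (induction P)
  case (Cons x P)
  obtain g A where x: "x = (g, A)" by fastforce
  have g: "g \<in> supp w" using walk_head Cons.prems x by blast
  have "dominated (alternating P)"
  proof (cases P)
    case Nil
    then show ?thesis by (auto simp: dominated_def intro!: exI[of _ 0])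
  next
    case (Cons y Q)
    then show ?thesis using Cons.IH Cons.prems walk_tl by blast
  qed
  from dominated_add[OF dominated_single[OF g] this] show ?case by (simp add: x)
qed simp

lemma has_sum_single: "((\<lambda>x. if x = g then a else 0) has_sum (if g \<in> B then a else (0::real))) B"
proof -
  have "((\<lambda>x. if x = g then a else 0) has_sum (\<Sum>x\<in>B \<inter> {g}. if x = g then a else 0)) (B \<inter> {g})"
    by (rule has_sum_finite) simp
  also have "?this \<longleftrightarrow> ((\<lambda>x. if x = g then a else 0) has_sum (\<Sum>x\<in>B \<inter> {g}. if x = g then a else 0)) B"
    by (rule has_sum_cong_neutral) auto
  finally show ?thesis by (cases "g \<in> B") auto
qed

text \<open>The exponent is \<open>0\<close> at the end of the list, so the first edge of the walk
  carries \<open>+1\<close>. Consecutive edges cancel at the node between them; only the start keeps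
  mass \<open>1\<close>, and the far end of the last edge, if it exists, receives the last
  sign.\<close>

lemma has_sum_alternating:
  assumes "walk P" "B \<in> \<Gamma>"
  shows "(alternating P has_sum (if B = snd (last P) then 1 else 0) +
     (if fst (hd P) \<in> B \<and> B \<noteq> snd (hd P) then (-1) ^ (length P - 1) else 0)) B"
  using assms
proof (induction P rule: walk.induct)
  case (2 g A)
  have "alternating [(g, A)] = (\<lambda>x. if x = g then 1 else 0)" by (simp add: fun_eq_iff)
  with 2 show ?case using has_sum_single[of g 1 B] by auto
next
  case (3 g A h C P)
  let ?R = "(h, C) # P" and ?e = "if B = snd (last ((h, C) # P)) then 1 else 0 :: real"
  have R: "walk ?R" using 3 by simp
  have len: "length (x # xs) - 1 = length xs" for x and xs :: "('a \<times> 'a set) list" by simp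
  have ih: "(alternating ?R has_sum ?e + (if h \<in> B \<and> B \<noteq> C then (-1) ^ length P else 0)) B"
    using "3.IH"[OF R "3.prems"(2)] unfolding list.sel fst_conv snd_conv len .
  \<comment> \<open>By \<open>at_most_two\<close>, the only end of \<open>h\<close> besides
    \<open>C\<close> is \<open>A\<close>. So the new edge \<open>g\<close> cancels the mass left at
    \<open>A\<close> and carries the opposite mass to its own far end.\<close>
  have "h \<in> B \<and> B \<noteq> C \<longleftrightarrow> B = A"
    using at_most_two[of A B C h] 3 walk_head[of h C P] by auto
  then have "(if g \<in> B then (-1) ^ length ?R else 0) +
      (?e + (if h \<in> B \<and> B \<noteq> C then (-1) ^ length P else 0)) =
    ?e + (if g \<in> B \<and> B \<noteq> A then (-1) ^ length ?R else (0::real))"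
    using 3 by simp
  with has_sum_add[OF has_sum_single[of g "(-1) ^ length ?R" B] ih]
  have "((\<lambda>x. (if x = g then (-1) ^ length ?R else 0) + alternating ?R x) has_sum
    ?e + (if g \<in> B \<and> B \<noteq> A then (-1) ^ length ?R else 0)) B" by metis
  then show ?case
    unfolding list.sel fst_conv snd_conv len alternating.simps(2)[of g A ?R] last.simps[of _ ?R] by simp
qed simp

text \<open>The second end of an edge is the node from which the next edge leaves, so it is recorded
  unless the edge is the last one. It comes after the first step, whence
  \<open>butlast\<close>.\<close>

lemma walk_edge_ends:
  assumes "walk P" "(x, C) \<in> set P" "x \<in> B" "B \<in> \<Gamma>" "B \<noteq> C"
  shows "x = fst (hd P) \<or> B \<in> snd ` set (butlast P)"
  using assms
proof (induction P rule: walk.induct)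
  case (3 g A h D P)
  show ?case
  proof (cases "(x, C) = (g, A)")
    case False
    then have mem: "(x, C) \<in> set ((h, D) # P)" using 3 by auto
    then have "x = h \<or> B \<in> snd ` set (butlast ((h, D) # P))" using 3 by auto
    then show ?thesis
    proof
      assume xh: "x = h"
      show ?thesis
      proof (cases "D = C")
        case True
        with xh 3 walk_head[of h D P] at_most_two[of A B D h] show ?thesis by auto
      next
        case False
        \<comment> \<open>Here \<open>h\<close> was also used earlier, from \<open>A\<close> towards
          \<open>D\<close>, so \<open>C = A\<close> and \<open>B = D\<close>; a step precedes this
          visit to \<open>D\<close>, so it survives \<open>butlast\<close>.\<close>
        with xh 3 walk_head[of h D P] walk_mem[OF _ mem] at_most_two[of A C D h] at_most_two[of B C D h]
        show ?thesis by auto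
      qed
    qed auto
  qed auto
qed auto

definition nodes :: "('a \<times> 'a set) list \<Rightarrow> 'a set list" where
  "nodes P = map snd P"

lemma nodes_simps [simp]: "nodes [] = []" "nodes ((g, A) # P) = A # nodes P"
  "nodes (P @ Q) = nodes P @ nodes Q"
  by (simp_all add: nodes_def)

lemma mem_nodes: "(x, C) \<in> set P \<Longrightarrow> C \<in> set (nodes P)"
  by (force simp: nodes_def)

lemma set_nodes: "set (nodes P) = snd ` set P"
  by (simp add: nodes_def)

text \<open>An edge used again leaves a different node, which is therefore its second end. That node
  has been visited already unless the two uses are consecutive, and these are ruled out because
  walks do not backtrack.\<close>

lemma distinct_nodes_imp_distinct_edges:
  "walk P \<Longrightarrow> distinct (nodes P) \<Longrightarrow> distinct (map fst P)"
proof (induction P rule: walk.induct)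
  case (3 g A h D P)
  have "g \<notin> fst ` set ((h, D) # P)"
  proof
    assume "g \<in> fst ` set ((h, D) # P)"
    then obtain C where C: "(g, C) \<in> set ((h, D) # P)" unfolding image_iff by (metis prod.collapse)
    have "A \<noteq> C" using mem_nodes[OF C] 3 by auto
    then have "g = h \<or> A \<in> snd ` set (butlast ((h, D) # P))"
      using walk_edge_ends[of "(h, D) # P" g C A] C 3 by auto
    moreover have "A \<notin> snd ` set ((h, D) # P)" using 3 by (auto simp: nodes_def)
    then have "A \<notin> snd ` set (butlast ((h, D) # P))" by (blast dest: in_set_butlastD)
    ultimately show False using 3 by auto
  qed
  then show ?case using 3 by auto
qed auto

lemma alternating_outside: "x \<notin> fst ` set P \<Longrightarrow> alternating P x = 0"
  by (induction P) auto

lemma alternating_head: "distinct (map fst ((g, A) # P)) \<Longrightarrow> alternating ((g, A) # P) g = (-1) ^ length P"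
  using alternating_outside[of g P] by (simp add: image_def)

lemma alternating_mem_nonzero:
  "distinct (map fst P) \<Longrightarrow> x \<in> fst ` set P \<Longrightarrow> alternating P x \<noteq> 0"
proof (induction P)
  case (Cons y P)
  obtain g A where y: "y = (g, A)" by fastforce
  show ?case
  proof (cases "x = g")
    case True
    then show ?thesis using Cons.prems(1) alternating_head[of g A P] y by simp
  next
    case False
    then show ?thesis using Cons y by auto
  qed
qed simp

text \<open>With distinct nodes, \<open>A\<close> is visited only at the start, so an edge touching
  \<open>A\<close> is the first one or the last one, whose far end is unconstrained.\<close>

lemma edges_at_start:
  assumes "walk P" "distinct (nodes P)" "last P = (g, A)" "x \<in> fst ` set P" "x \<in> A"
  shows "x = g \<or> x = fst (hd P)"
proof -
  from assms(4) obtain C where C: "(x, C) \<in> set P" by auto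
  have P: "P \<noteq> []" using assms(1) by auto
  have A: "A \<in> \<Gamma>" using walk_mem[OF assms(1), of g A] assms(3) last_in_set[OF P] by simp
  have split: "P = butlast P @ [(g, A)]" using append_butlast_last_id[OF P] assms(3) by simp
  have nA: "A \<notin> snd ` set (butlast P)"
    using assms(2) by (subst (asm) split) (simp add: nodes_def)
  show ?thesis
  proof (cases "C = A")
    case True
    then have "(x, C) \<notin> set (butlast P)" using nA by force
    then have "(x, C) = (g, A)" using C by (subst (asm) split) auto
    then show ?thesis by simp
  next
    case False
    then show ?thesis using walk_edge_ends[OF assms(1) C assms(5) A] nA by auto
  qed
qed

lemma alternating_first: "distinct (map fst P) \<Longrightarrow> P \<noteq> [] \<Longrightarrow> alternating P (fst (last P)) = 1"
proof (induction P)
  case (Cons x P)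
  show ?case
  proof (cases "P = []")
    case False
    then have "fst (last P) \<in> fst ` set P" by simp
    then show ?thesis using False Cons by (cases x) auto
  qed (cases x, simp)
qed simp

section \<open>Walks from a fixed edge and Green functions\<close>

definition start_green :: "'a \<Rightarrow> 'a set \<Rightarrow> ('a \<Rightarrow> real) \<Rightarrow> bool" where
  "start_green g A z \<longleftrightarrow> balanced_off A z \<and> z g \<noteq> 0 \<and> (\<forall>x\<in>A. x \<noteq> g \<longrightarrow> z x = 0)"

definition walks_from :: "'a \<Rightarrow> 'a set \<Rightarrow> ('a \<times> 'a set) list set" where
  "walks_from g A = {P. walk P \<and> last P = (g, A)}"

lemma walks_fromD:
  assumes "P \<in> walks_from g A"
  shows "walk P" "last P = (g, A)" "P \<noteq> []" "A \<in> set (nodes P)" "A \<in> \<Gamma>" "g \<in> A" "g \<in> supp w"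
proof -
  show w: "walk P" and l: "last P = (g, A)" using assms by (auto simp: walks_from_def)
  then show n: "P \<noteq> []" by auto
  have m: "(g, A) \<in> set P" using last_in_set[OF n] l by simp
  then show "A \<in> set (nodes P)" by (rule mem_nodes)
  show "A \<in> \<Gamma>" "g \<in> A" "g \<in> supp w" using walk_mem[OF w m] by auto
qed

lemma has_sum_alternating_into:
  assumes "P \<in> walks_from g A" "B \<in> \<Gamma>" "fst (hd P) \<in> B" "B \<noteq> snd (hd P)" "C \<in> \<Gamma>"
  shows "(alternating P has_sum (if C = A then 1 else 0) +
    (if C = B then (-1) ^ (length P - 1) else 0)) C"
proof -
  note P = walks_fromD[OF assms(1)]
  have h: "snd (hd P) \<in> \<Gamma>" "fst (hd P) \<in> snd (hd P)"
    using walk_mem[OF P(1), of "fst (hd P)" "snd (hd P)"] P(3) by auto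
  have "fst (hd P) \<in> C \<and> C \<noteq> snd (hd P) \<longleftrightarrow> C = B"
    using at_most_two[OF assms(2) h(1) assms(5) assms(3) h(2)] assms(3,4) by auto
  with has_sum_alternating[OF P(1) assms(5)] P(2) show ?thesis by simp
qed

text \<open>The far end of the last edge is a node \<open>B\<close> other than \<open>A\<close>, so
  the last edge touches \<open>A\<close> only by leaving it, which makes it the first edge
  \<open>g\<close>.\<close>

lemma alternating_at_start:
  assumes "P \<in> walks_from g A" "distinct (nodes P)" "B \<in> \<Gamma>" "B \<noteq> A" "B \<noteq> snd (hd P)"
    "fst (hd P) \<in> B" "x \<in> A" "x \<noteq> g"
  shows "alternating P x = 0"
proof (rule ccontr)
  note P = walks_fromD[OF assms(1)]
  assume "alternating P x \<noteq> 0"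
  then have "x \<in> fst ` set P" using alternating_outside by blast
  then have x: "x = fst (hd P)" using edges_at_start[OF P(1) assms(2) P(2) _ assms(7)] assms(8) by blast
  obtain k C P' where P': "P = (k, C) # P'" using P(3) by (cases P) auto
  have kC: "C \<in> \<Gamma>" "k \<in> C" using P(1) P' walk_head by auto
  have "A = C" using at_most_two[of A B C k] kC P(5) assms P' x by auto
  then have "P' = []" using assms(2) P(2) P' by (cases P' rule: rev_cases) (auto simp: nodes_def)
  with x P' P(2) assms(8) show False by simp
qed

end

section \<open>Rigidity and walks that meet\<close>

locale rigid_weighting = weighting +
  assumes rigid: "\<lbrakk>dominated u; \<And>A. A \<in> \<Gamma> \<Longrightarrow> (u has_sum 0) A\<rbrakk> \<Longrightarrow> u g = 0"
begin

text \<open>If \<open>s\<close> and \<open>t\<close> are the sums of \<open>z\<close> and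
  \<open>u\<close> at \<open>A\<close>, then \<open>s u - t z\<close> is balanced at every member
  and vanishes, while \<open>s \<noteq> 0\<close>. So functions with pole \<open>A\<close> are
  proportional, and two of them with incompatible zeros are contradictory.\<close>

lemma balanced_off_unique:
  assumes z: "balanced_off A z" "z y \<noteq> 0" "z x = 0" and u: "balanced_off A u" and A: "A \<in> \<Gamma>"
  shows "u x = 0"
proof -
  have dz: "dominated z" and du: "dominated u" using z u by (auto simp: balanced_off_def)
  obtain s t where s: "(z has_sum s) A" and t: "(u has_sum t) A"
    using dominated_summable[OF dz A] dominated_summable[OF du A] by (auto simp: summable_on_def)
  have "s \<noteq> 0"
  proof
    assume "s = 0"
    then have "(z has_sum 0) B" if "B \<in> \<Gamma>" for B using that s z(1) by (cases "B = A") (auto simp: balanced_off_def)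
    then show False using rigid[OF dz] z(2) by blast
  qed
  have "(\<lambda>x. s * u x + (- t) * z x) x = 0"
  proof (rule rigid)
    show "dominated (\<lambda>x. s * u x + (- t) * z x)" by (intro dominated_add dominated_scale du dz)
    show "((\<lambda>x. s * u x + (- t) * z x) has_sum 0) B" if "B \<in> \<Gamma>" for B
    proof (cases "B = A")
      case True
      show ?thesis using has_sum_add[OF has_sum_cmult_right[OF t, of s] has_sum_cmult_right[OF s, of "- t"]] True by simp
    next
      case False
      then have "(z has_sum 0) B" "(u has_sum 0) B" using that z u by (auto simp: balanced_off_def)
      then show ?thesis
        using has_sum_add[OF has_sum_cmult_right[of u B 0 s] has_sum_cmult_right[of z B 0 "- t"]] by simp
    qed
  qed
  then show ?thesis using \<open>s \<noteq> 0\<close> z(3) by simp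
qed

text \<open>The masses that the two walks leave at \<open>B\<close> are equal or opposite. If equal,
  the difference is balanced everywhere but nonzero at the last edge of \<open>P\<close>, which
  \<open>Q\<close> does not contain. If opposite, the sum is balanced off \<open>A\<close> and
  equals \<open>2\<close> at \<open>g\<close>. The walks may share an initial stretch.\<close>

lemma joining_walks:
  assumes P: "P \<in> walks_from g A" "distinct (nodes P)" "B \<notin> set (nodes P)" "fst (hd P) \<in> B"
    and Q: "Q \<in> walks_from g A" "distinct (nodes Q)" "B \<notin> set (nodes Q)" "fst (hd Q) \<in> B"
    and B: "B \<in> \<Gamma>" and ne: "fst (hd P) \<noteq> fst (hd Q)"
  shows "\<exists>z. start_green g A z"
proof -
  note P' = walks_fromD[OF P(1)] and Q' = walks_fromD[OF Q(1)]
  have BA: "B \<noteq> A" using P(3) P'(4) by auto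
  have BP: "B \<noteq> snd (hd P)" and BQ: "B \<noteq> snd (hd Q)"
    using P(3) Q(3) P'(3) Q'(3) by (auto simp: nodes_def)
  note sP = has_sum_alternating_into[OF P(1) B P(4) BP]
  note sQ = has_sum_alternating_into[OF Q(1) B Q(4) BQ]
  note dP = distinct_nodes_imp_distinct_edges[OF P'(1) P(2)]
  note dQ = distinct_nodes_imp_distinct_edges[OF Q'(1) Q(2)]
  let ?a = "(-1) ^ (length P - 1) :: real" and ?b = "(-1) ^ (length Q - 1) :: real"
  have "?a = ?b \<or> ?a = - ?b" by (cases "even (length P - 1)"; cases "even (length Q - 1)") auto
  then show ?thesis
  proof
    assume ab: "?a = ?b"
    let ?u = "\<lambda>x. alternating P x + (-1) * alternating Q x"
    have "?u (fst (hd P)) = 0"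
    proof (rule rigid)
      show "dominated ?u" by (intro dominated_add dominated_scale dominated_alternating P' Q')
      show "(?u has_sum 0) C" if "C \<in> \<Gamma>" for C
        using has_sum_add[OF sP[OF that] has_sum_cmult_right[OF sQ[OF that], of "-1"]]
        unfolding ab by simp
    qed
    moreover have "alternating P (fst (hd P)) \<noteq> 0"
      using alternating_mem_nonzero[OF dP] P'(3) by simp
    ultimately have "fst (hd P) \<in> fst ` set Q" using alternating_outside[of "fst (hd P)" Q] by fastforce
    then obtain C where C: "(fst (hd P), C) \<in> set Q" by auto
    have "B \<noteq> C" using Q(3) mem_nodes[OF C] by auto
    with walk_edge_ends[OF Q'(1) C P(4) B] ne have "B \<in> snd ` set (butlast Q)" by auto
    with Q(3) show ?thesis by (auto simp: set_nodes dest: in_set_butlastD)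
  next
    assume ab: "?a = - ?b"
    let ?z = "\<lambda>x. alternating P x + alternating Q x"
    have "balanced_off A ?z" unfolding balanced_off_def
    proof (intro conjI ballI impI)
      show "dominated ?z" by (intro dominated_add dominated_alternating P' Q')
      show "(?z has_sum 0) C" if "C \<in> \<Gamma>" "C \<noteq> A" for C
        using has_sum_add[OF sP[OF that(1)] sQ[OF that(1)]] that(2) unfolding ab by (cases "C = B") simp_all
    qed
    moreover have "?z g = 2"
      using alternating_first[OF dP P'(3)] alternating_first[OF dQ Q'(3)] P'(2) Q'(2) by simp
    moreover have "?z x = 0" if "x \<in> A" "x \<noteq> g" for x
      using alternating_at_start[OF P(1,2) B BA BP P(4) that]
        alternating_at_start[OF Q(1,2) B BA BQ Q(4) that] by simp
    ultimately show ?thesis unfolding start_green_def by (intro exI[of _ ?z]) auto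
  qed
qed

text \<open>The walks form a tree. Going backwards from a common last edge, the first disagreement
  produces two walks that reach a new node by different edges, and \<open>joining_walks\<close>
  applies.\<close>

lemma walks_from_unique:
  assumes dist: "\<And>P. P \<in> walks_from g A \<Longrightarrow> distinct (nodes P)"
    and lt: "w g < 1" and no_green: "\<nexists>z. start_green g A z"
  shows "P \<in> walks_from g A \<Longrightarrow> Q \<in> walks_from g A \<Longrightarrow> fst (hd P) = fst (hd Q) \<Longrightarrow> P = Q"
proof (induction P arbitrary: Q)
  case Nil
  then show ?case by (simp add: walks_from_def)
next
  \<comment> \<open>A walk using \<open>g\<close> again either leaves \<open>A\<close> once more or
    enters \<open>A\<close> by \<open>g\<close>; in the latter case \<open>w g < 1\<close> provides
    another edge at \<open>A\<close> to continue. Both repeat the node \<open>A\<close>.\<close>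
  have no_return: False if R: "(g, B) # R \<in> walks_from g A" and "R \<noteq> []" for B R
  proof (cases "B = A")
    case True
    with dist[OF R] R \<open>R \<noteq> []\<close> show False
      by (cases R rule: rev_cases) (auto simp: walks_from_def)
  next
    case False
    note R' = walks_fromD[OF R]
    obtain h where h: "h \<in> A" "h \<in> supp w" "h \<noteq> g" using ex_other[OF R'(5) lt] by auto
    have "(h, A) # (g, B) # R \<in> walks_from g A"
      using h False R' by (auto simp: walks_from_def)
    from dist[OF this] R'(4) show False by simp
  qed
  case (Cons x P Q)
  obtain h B where x: "x = (h, B)" by fastforce
  obtain C Q' where Q: "Q = (h, C) # Q'" using Cons.prems x by (cases Q) (auto simp: walks_from_def)
  note W = Cons.prems(1)[unfolded x] note W' = Cons.prems(2)[unfolded Q]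
  consider "P = []" "Q' = []" | "P = []" "Q' \<noteq> []" | "P \<noteq> []" "Q' = []" | "P \<noteq> []" "Q' \<noteq> []" by auto
  then show ?case
  proof cases
    case 1
    then show ?thesis using W W' x Q by (auto simp: walks_from_def)
  next
    case 2
    then have "h = g" using W by (auto simp: walks_from_def)
    then show ?thesis using no_return W' 2 by blast
  next
    case 3
    then have "h = g" using W' by (auto simp: walks_from_def)
    then show ?thesis using no_return W 3 by blast
  next
    case 4
    obtain k D P'' where P: "P = (k, D) # P''" using 4 by (cases P) auto
    obtain l E Q'' where Q': "Q' = (l, E) # Q''" using 4 by (cases Q') auto
    have PW: "P \<in> walks_from g A" and QW: "Q' \<in> walks_from g A"
      using W W' P Q' by (auto simp: walks_from_def)
    note dP = dist[OF W] and dQ = dist[OF W']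
    show ?thesis
    proof (cases "B = C")
      case True
      show ?thesis
      proof (cases "k = l")
        case True
        then have "P = Q'" using Cons.IH[OF PW QW] P Q' by simp
        then show ?thesis using x Q \<open>B = C\<close> by simp
      next
        case False
        have "\<exists>z. start_green g A z"
          using joining_walks[OF PW _ _ _ QW, of B] dP dQ P Q' W W' \<open>B = C\<close> False
          by (auto simp: walks_from_def)
        with no_green show ?thesis by blast
      qed
    next
      case False
      \<comment> \<open>The walks leave \<open>h\<close> from its two ends. Crossing
        \<open>h\<close>, the first arrives at \<open>C\<close>, which the second reached by
        \<open>l\<close>; continuing the first through \<open>l\<close> shows that \<open>C\<close>
        is new to it.\<close>
      have ext: "(l, C) # (h, B) # P \<in> walks_from g A"
        using W W' False Q' walk_head[of l E Q''] by (auto simp: walks_from_def)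
      have "\<exists>z. start_green g A z"
        using joining_walks[OF W _ _ _ QW, of C] dP dQ dist[OF ext] P Q' W W' False
        by (auto simp: walks_from_def)
      with no_green show ?thesis by blast
    qed
  qed
qed

end

section \<open>The proportional flow on a tree of walks\<close>

context weighting
begin

text \<open>The mass on the last edge divided by its weight. Mass \<open>w h * r\<close> arriving by
  \<open>h\<close> is passed on with opposite sign to the other edges of the node, whose weights add
  up to \<open>1 - w h\<close>; in proportion to \<open>w\<close>, each gets the ratio
  \<open>- r * (w h / (1 - w h))\<close>.\<close>

fun flow_ratio :: "('a \<times> 'a set) list \<Rightarrow> real" where
  "flow_ratio [] = 0"
| "flow_ratio [x] = 1"
| "flow_ratio (x # (h, B) # P) = - flow_ratio ((h, B) # P) * (w h / (1 - w h))"

text \<open>Two successive edges \<open>g\<close>, \<open>h\<close> contribute the factors \<open>w g / (1 - w g)\<close> and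
  \<open>w h / (1 - w h)\<close>, whose product is at most one because \<open>w g + w h \<le> 1\<close>. Hence the ratio
  stays bounded although single factors may be large.\<close>

lemma flow_ratio_bound:
  assumes "w g < 1"
  shows "walk P \<Longrightarrow> last P = (g, A) \<Longrightarrow>
    \<bar>flow_ratio P\<bar> \<le> max 1 (w g / (1 - w g)) \<and>
    \<bar>flow_ratio P\<bar> * (w (fst (hd P)) / (1 - w (fst (hd P)))) \<le> max 1 (w g / (1 - w g))"
proof (induction P rule: walk.induct)
  case (3 x B h C P)
  let ?M = "max 1 (w g / (1 - w g))" and ?r = "\<bar>flow_ratio ((h, C) # P)\<bar>"
  have ih: "?r \<le> ?M" "?r * (w h / (1 - w h)) \<le> ?M" using 3 by auto
  have x: "0 < w x" using 3 pos by simp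
  have h: "0 < w h" using 3 pos walk_head[of h C P] by simp
  have xh: "w x + w h \<le> 1" using 3 pair_le_one[of B x h] by auto
  have "w h * w x \<le> (1 - w h) * (1 - w x)" using xh by (simp add: algebra_simps)
  then have "(w h / (1 - w h)) * (w x / (1 - w x)) \<le> 1"
    using xh x h by (simp add: divide_simps)
  then have le: "?r * ((w h / (1 - w h)) * (w x / (1 - w x))) \<le> ?r"
    by (intro mult_left_le) auto
  have eq: "\<bar>flow_ratio ((x, B) # (h, C) # P)\<bar> = ?r * (w h / (1 - w h))"
    using h xh x by (simp add: abs_mult)
  show ?case unfolding eq using ih le by (simp add: mult.assoc)
qed auto

text \<open>The flow runs along all walks at once. Uniqueness makes the mass on an edge well
  defined, \<open>flow_ratio_bound\<close> gives domination, and the ratios balance every node other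
  than \<open>A\<close> that a walk enters.\<close>

lemma ex_start_green_flow:
  assumes A: "A \<in> \<Gamma>" "g \<in> A" "g \<in> supp w" and lt: "w g < 1"
    and uniq: "\<And>P Q. P \<in> walks_from g A \<Longrightarrow> Q \<in> walks_from g A \<Longrightarrow> fst (hd P) = fst (hd Q) \<Longrightarrow> P = Q"
  shows "\<exists>z. start_green g A z"
proof -
  let ?W = "walks_from g A"
  define R where "R x \<longleftrightarrow> (\<exists>P\<in>?W. fst (hd P) = x)" for x
  define u where "u x = (if R x then w x * flow_ratio (SOME P. P \<in> ?W \<and> fst (hd P) = x) else 0)" for x
  have u: "u (fst (hd P)) = w (fst (hd P)) * flow_ratio P" if P: "P \<in> ?W" for P
  proof -
    let ?Q = "SOME Q. Q \<in> ?W \<and> fst (hd Q) = fst (hd P)"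
    have "?Q \<in> ?W \<and> fst (hd ?Q) = fst (hd P)" by (rule someI[of _ P]) (use P in simp)
    then have "?Q = P" using uniq P by blast
    then show ?thesis using P by (auto simp: u_def R_def)
  qed
  have u0: "u x = 0" if "\<not> R x" for x using that by (simp add: u_def)
  let ?M = "max 1 (w g / (1 - w g))"
  have dom: "\<bar>u x\<bar> \<le> ?M * w x" for x
  proof (cases "R x")
    case True
    then obtain P where P: "P \<in> ?W" "fst (hd P) = x" by (auto simp: R_def)
    have "\<bar>flow_ratio P\<bar> \<le> ?M"
      using flow_ratio_bound[OF lt walks_fromD(1,2)[OF P(1)]] by blast
    then have "\<bar>flow_ratio P\<bar> * w x \<le> ?M * w x" using nonneg by (rule mult_right_mono)
    then show ?thesis using u[OF P(1)] P(2) nonneg[of x] by (simp add: abs_mult mult.commute)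
  next
    case False
    then show ?thesis using u0 nonneg[of x] by (simp add: le_max_iff_disj)
  qed
  have start: "[(g, A)] \<in> ?W" using A by (simp add: walks_from_def)
  have no_return: "P = []" if "(g, B) # P \<in> ?W" for B P
    using uniq[OF that start] by simp
  \<comment> \<open>A walk reaching another edge at \<open>A\<close> would yield a walk ending in
    \<open>g\<close> other than the trivial one, against uniqueness.\<close>
  have start0: "u x = 0" if x: "x \<in> A" "x \<noteq> g" for x
  proof (rule u0, rule notI)
    assume "R x"
    then obtain P where P: "P \<in> ?W" "fst (hd P) = x" by (auto simp: R_def)
    obtain B Q where PB: "P = (x, B) # Q" using P walks_fromD(3)[OF P(1)] by (cases P) auto
    have Q: "Q \<noteq> []" using P PB x by (auto simp: walks_from_def)
    obtain k D S where QD: "Q = (k, D) # S" using Q by (cases Q) auto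
    show False
    proof (cases "B = A")
      case False
      then have "(g, A) # P \<in> ?W" using P A x PB by (auto simp: walks_from_def)
      from no_return[OF this] PB show False by simp
    next
      case True
      have QW: "Q \<in> ?W" using P PB QD by (auto simp: walks_from_def)
      have kA: "k \<in> A" "A \<noteq> D" using P PB QD True by (auto simp: walks_from_def)
      show False
      proof (cases "k = g")
        case True
        with no_return[of D S] QW QD have "S = []" by simp
        with QW QD kA show False by (auto simp: walks_from_def)
      next
        case False
        then have "(g, A) # Q \<in> ?W" using QW QD kA A by (auto simp: walks_from_def)
        from no_return[OF this] QD show False by simp
      qed
    qed
  qed
  have bal: "(u has_sum 0) C" if C: "C \<in> \<Gamma>" "C \<noteq> A" for C
  proof (cases "\<exists>x\<in>C. R x")
    case False
    then show ?thesis by (intro has_sum_0) (auto simp: u0)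
  next
    case True
    then obtain h P where P: "P \<in> ?W" "fst (hd P) = h" "h \<in> C" by (auto simp: R_def)
    obtain B Q where PB: "P = (h, B) # Q" using P walks_fromD(3)[OF P(1)] by (cases P) auto
    \<comment> \<open>If the walk leaves \<open>C\<close> through its last edge, then the walk one
      step shorter enters \<open>C\<close>.\<close>
    have "\<exists>K\<in>?W. fst (hd K) \<in> C \<and> snd (hd K) \<noteq> C"
    proof (cases "B = C")
      case False
      with P PB show ?thesis by (intro bexI[of _ P]) auto
    next
      case True
      then have "Q \<noteq> []" using P PB C by (auto simp: walks_from_def)
      then obtain k D S where QD: "Q = (k, D) # S" by (cases Q) auto
      show ?thesis
        by (intro bexI[of _ Q]) (use P PB QD True in \<open>auto simp: walks_from_def\<close>)
    qed
    then obtain k D S where K: "(k, D) # S \<in> ?W" "k \<in> C" "D \<noteq> C"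
      by (metis list.exhaust_sel prod.collapse walks_fromD(3))
    let ?K = "(k, D) # S"
    have kpos: "0 < w k" using K(1) walk_head[of k D S] pos by (auto simp: walks_from_def)
    have k1: "w k < 1"
    proof (cases S)
      case Nil
      then show ?thesis using K lt by (auto simp: walks_from_def)
    next
      case (Cons y T)
      obtain l E where y: "y = (l, E)" by fastforce
      have W: "walk ((k, D) # (l, E) # T)" using K(1) Cons y by (auto simp: walks_from_def)
      then have "0 < w l" using walk_head[of l E T] pos by simp
      moreover have "w k + w l \<le> 1" using W pair_le_one[of D k l] by auto
      ultimately show ?thesis by simp
    qed
    define c where "c = - flow_ratio ?K * (w k / (1 - w k))"
    have uk: "u k = w k * flow_ratio ?K" using u[OF K(1)] by simp
    have ux: "u x = c * w x" if x: "x \<in> C" "x \<noteq> k" for x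
    proof (cases "x \<in> supp w")
      case True
      then have "(x, C) # ?K \<in> ?W" using x K C by (auto simp: walks_from_def)
      from u[OF this] show ?thesis by (simp add: c_def)
    next
      case False
      have "\<not> R x"
      proof
        assume "R x"
        then obtain P where P: "P \<in> ?W" "fst (hd P) = x" by (auto simp: R_def)
        from walks_fromD(1,3)[OF P(1)] have "x \<in> supp w"
          using walk_mem[of P x "snd (hd P)"] P(2) by (metis list.set_sel(1) prod.collapse)
        with False show False by simp
      qed
      with False show ?thesis by (simp add: u0 supp_def)
    qed
    \<comment> \<open>On \<open>C\<close> the flow is \<open>c * w\<close> except at the entering
      edge \<open>k\<close>, so its sum is \<open>c * (1 - w k) + u k\<close>, which vanishes by the
      choice of \<open>c\<close>.\<close>
    have "((\<lambda>x. c * w x + (if x = k then u k - c * w k else 0)) has_sum c * 1 + (u k - c * w k)) C"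
      using has_sum_add[OF has_sum_cmult_right[OF has_sum_one[OF C(1)], of c] has_sum_single[of k "u k - c * w k" C]]
        K(2) by simp
    moreover have "c * 1 + (u k - c * w k) = 0"
      using k1 by (simp add: c_def uk field_simps)
    moreover have "((\<lambda>x. c * w x + (if x = k then u k - c * w k else 0)) has_sum 0) C \<longleftrightarrow> (u has_sum 0) C"
      by (rule has_sum_cong) (use ux in auto)
    ultimately show ?thesis by simp
  qed
  have "u g \<noteq> 0" using u[OF start] pos[OF A(3)] by simp
  then have "start_green g A u"
    unfolding start_green_def balanced_off_def dominated_def using dom bal start0 by blast
  then show ?thesis by blast
qed

text \<open>The far end of the last edge is the start. The lower bound on the length excludes a
  single edge, for which the closing condition is trivial.\<close>

definition odd_circuit :: "('a \<times> 'a set) list \<Rightarrow> bool" where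
  "odd_circuit P \<longleftrightarrow> walk P \<and> distinct (nodes P) \<and> odd (length P) \<and> 2 \<le> length P \<and>
     fst (hd P) \<in> snd (last P)"

text \<open>Since the length is odd, the closing edge brings mass \<open>+1\<close> back to
  \<open>A\<close> instead of cancelling the mass there. Besides \<open>start_green\<close>, this is
  the second source of functions with pole \<open>A\<close> that do not vanish at
  \<open>g\<close>.\<close>

lemma odd_circuit_balanced:
  assumes "odd_circuit P" "P \<in> walks_from g A"
  shows "balanced_off A (alternating P)" "alternating P g = 1"
proof -
  note P = walks_fromD[OF assms(2)] and c = assms(1)[unfolded odd_circuit_def]
  have A: "fst (hd P) \<in> A" using c P(2) by simp
  have "A \<noteq> snd (hd P)"
  proof -
    obtain x Q where PQ: "P = x # Q" "Q \<noteq> []" using c by (cases P; cases "tl P") auto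
    then have "A \<in> set (nodes Q)" using P(2) by (metis last.simps last_in_set mem_nodes)
    then show ?thesis using c PQ by (cases x) auto
  qed
  then have "(alternating P has_sum 0) B" if "B \<in> \<Gamma>" "B \<noteq> A" for B
    using has_sum_alternating_into[OF assms(2) P(5) A _ that(1)] that(2) by simp
  then show "balanced_off A (alternating P)"
    unfolding balanced_off_def using dominated_alternating[OF P(1)] by blast
  show "alternating P g = 1"
    using alternating_first[OF distinct_nodes_imp_distinct_edges] c P(2,3) by fastforce
qed

end

section \<open>Walks that return to a visited node\<close>

context rigid_weighting
begin

text \<open>At the first repeated node \<open>B\<close>, the walk \<open>P\<close> splits into the
  stick \<open>P2\<close> from \<open>A\<close> to \<open>B\<close> and a cycle. Without a stick, an
  even cycle contradicts rigidity, so the cycle is odd. With a stick, an even cycle makes the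
  difference of the two alternating functions balanced everywhere, and an odd one turns their sum
  into a Green function at \<open>g\<close>; both are excluded.\<close>

lemma lollipop:
  assumes no_green: "\<nexists>z. start_green g A z"
  shows "P \<in> walks_from g A \<Longrightarrow> \<not> distinct (nodes P) \<Longrightarrow> \<exists>Q\<in>walks_from g A. odd_circuit Q"
proof (induction P)
  case (Cons x P)
  obtain h B where x: "x = (h, B)" by fastforce
  have Pne: "P \<noteq> []" using Cons.prems(2) by (cases x; cases P) auto
  have PW: "P \<in> walks_from g A"
    using Cons.prems(1) Pne walk_tl[of x P] by (simp add: walks_from_def)
  show ?case
  proof (cases "distinct (nodes P)")
    case False
    then show ?thesis using Cons.IH PW by blast
  next
    case dist: True
    note P = walks_fromD[OF PW]
    obtain k D R where PD: "P = (k, D) # R" using Pne by (cases P) auto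
    have B: "B \<in> \<Gamma>" "k \<in> B" "B \<noteq> D"
      using Cons.prems(1) x PD by (auto simp: walks_from_def)
    note dP = distinct_nodes_imp_distinct_edges[OF P(1) dist]
    note sP = has_sum_alternating_into[OF PW B(1)]
    have altk: "alternating P k \<noteq> 0" by (rule alternating_mem_nonzero[OF dP]) (simp add: PD)
    have "B \<in> set (nodes P)" using Cons.prems(2) dist x by simp
    then obtain b where "(b, B) \<in> set P" by (auto simp: nodes_def)
    then obtain P1 P2 where split: "P = P1 @ (b, B) # P2" by (meson split_list)
    have P1: "P1 \<noteq> []" using split PD B(3) by auto
    show ?thesis
    proof (cases "P2 = []")
      case True
      then have BA: "B = A" using P(2) split by simp
      have "odd (length P)"
      proof
        assume e: "even (length P)"
        then have o: "odd (length P - 1)" using Pne by (cases P) auto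
        have "alternating P k = 0"
        proof (rule rigid)
          show "dominated (alternating P)" using dominated_alternating P by blast
          show "(alternating P has_sum 0) C" if "C \<in> \<Gamma>" for C
            using sP[OF _ _ that] B PD BA o by (auto split: if_splits)
        qed
        with altk show False by simp
      qed
      moreover have "2 \<le> length P" using P1 split by (cases P1) auto
      ultimately have "odd_circuit P"
        using P dist B PD BA by (simp add: odd_circuit_def)
      with PW show ?thesis by blast
    next
      case False
      have W2: "walk ((b, B) # P2)" using walk_append[of P1 "(b, B) # P2"] P(1) split by simp
      have P2W: "P2 \<in> walks_from g A"
        using walk_tl[OF W2 False] P(2) split False by (simp add: walks_from_def)
      note P2 = walks_fromD[OF P2W]
      have into: "fst (hd P2) \<in> B" "B \<noteq> snd (hd P2)"
        using W2 False by (cases P2; auto)+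
      have d2: "distinct (nodes P2)" using dist split by simp
      note dP2 = distinct_nodes_imp_distinct_edges[OF P2(1) d2]
      have BA: "B \<noteq> A" using P2(4) dist split by auto
      have Bh: "fst (hd P) \<in> B" "B \<noteq> snd (hd P)" using B PD by auto
      note sP' = sP[OF Bh] and sQ = has_sum_alternating_into[OF P2W B(1) into]
      let ?a = "(-1) ^ (length P - 1) :: real" and ?b = "(-1) ^ (length P2 - 1) :: real"
      have "?a = ?b \<or> ?a = - ?b" by (cases "even (length P - 1)"; cases "even (length P2 - 1)") auto
      then show ?thesis
      proof
        assume ab: "?a = ?b"
        let ?u = "\<lambda>x. alternating P x + (-1) * alternating P2 x"
        have "?u k = 0"
        proof (rule rigid)
          show "dominated ?u" by (intro dominated_add dominated_scale dominated_alternating P P2)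
          show "(?u has_sum 0) C" if "C \<in> \<Gamma>" for C
            using has_sum_add[OF sP'[OF that] has_sum_cmult_right[OF sQ[OF that], of "-1"]]
            unfolding ab by simp
        qed
        \<comment> \<open>The closing edge \<open>k\<close> lies on the cycle and not on the stick,
          so the difference is nonzero at \<open>k\<close>.\<close>
        moreover have "k \<notin> fst ` set P2"
        proof -
          have "set P2 \<subseteq> set R" using split PD P1 by (cases P1) auto
          moreover have "k \<notin> fst ` set R" using dP PD by simp
          ultimately show ?thesis by blast
        qed
        ultimately show ?thesis using altk alternating_outside by fastforce
      next
        assume ab: "?a = - ?b"
        let ?z = "\<lambda>x. alternating P x + alternating P2 x"
        have "balanced_off A ?z" unfolding balanced_off_def
        proof (intro conjI ballI impI)
          show "dominated ?z" by (intro dominated_add dominated_alternating P P2)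
          show "(?z has_sum 0) C" if "C \<in> \<Gamma>" "C \<noteq> A" for C
            using has_sum_add[OF sP'[OF that(1)] sQ[OF that(1)]] that(2) unfolding ab by (cases "C = B") simp_all
        qed
        moreover have "?z g = 2"
          using alternating_first[OF dP P(3)] alternating_first[OF dP2 P2(3)] P(2) P2(2) by simp
        moreover have "?z x = 0" if "x \<in> A" "x \<noteq> g" for x
          using alternating_at_start[OF PW dist B(1) BA Bh(2,1) that]
            alternating_at_start[OF P2W d2 B(1) BA into(2,1) that] by simp
        ultimately have "start_green g A ?z" unfolding start_green_def by auto
        with no_green show ?thesis by blast
      qed
    qed
  qed
qed (simp add: walks_from_def)

lemma ex_odd_circuit_if_no_green:
  assumes "A \<in> \<Gamma>" "g \<in> A" "g \<in> supp w" "w g < 1" "\<nexists>z. start_green g A z"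
  shows "\<exists>P\<in>walks_from g A. odd_circuit P"
proof (cases "\<forall>P\<in>walks_from g A. distinct (nodes P)")
  case True
  have "\<exists>z. start_green g A z"
    by (rule ex_start_green_flow[OF assms(1-4)], rule walks_from_unique[of g A])
       (use True assms in auto)
  with assms(5) show ?thesis by blast
next
  case False
  then show ?thesis using lollipop assms(5) by blast
qed

lemma ex_balanced_off:
  assumes "A \<in> \<Gamma>" "g \<in> A" "g \<in> supp w" "w g < 1"
  shows "\<exists>z. balanced_off A z \<and> z g \<noteq> 0"
proof (cases "\<exists>z. start_green g A z")
  case True
  then show ?thesis by (auto simp: start_green_def)
next
  case False
  from ex_odd_circuit_if_no_green[OF assms False]
  obtain P where "P \<in> walks_from g A" "odd_circuit P" by blast
  from odd_circuit_balanced[OF this(2,1)] show ?thesis by (intro exI[of _ "alternating P"]) auto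
qed

lemma other_lt_one:
  assumes "A \<in> \<Gamma>" "g \<in> A" "h \<in> A" "g \<in> supp w" "h \<noteq> g"
  shows "w h < 1"
  using pair_le_one[OF assms(1-3)] pos[OF assms(4)] assms(5) by auto

text \<open>A Green function at \<open>g\<close> vanishes at the other edges of \<open>A\<close>,
  and the function of an odd circuit at all but two edges of \<open>A\<close>. But every support
  edge \<open>x\<close> at \<open>A\<close> of weight below \<open>1\<close> has a function with
  pole \<open>A\<close> nonzero at \<open>x\<close>, so \<open>balanced_off_unique\<close> excludes
  the first and leaves only two edges in the second.\<close>

lemma ex_odd_circuit:
  assumes "A \<in> \<Gamma>" "g \<in> A" "g \<in> supp w" "w g < 1"
  shows "\<exists>P\<in>walks_from g A. odd_circuit P \<and> A \<inter> supp w = {g, fst (hd P)}"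
proof -
  have "\<nexists>z. start_green g A z"
  proof
    assume "\<exists>z. start_green g A z"
    then obtain z where z: "balanced_off A z" "z g \<noteq> 0" "\<And>x. x \<in> A \<Longrightarrow> x \<noteq> g \<Longrightarrow> z x = 0"
      by (auto simp: start_green_def)
    obtain h where h: "h \<in> A" "h \<in> supp w" "h \<noteq> g" using ex_other[OF assms(1,4)] by blast
    have "w h < 1" using other_lt_one[OF assms(1,2) h(1) assms(3) h(3)] .
    from ex_balanced_off[OF assms(1) h(1,2) this] obtain u where "balanced_off A u" "u h \<noteq> 0" by blast
    with balanced_off_unique[OF z(1,2) z(3)[OF h(1,3)] this(1) assms(1)] show False by simp
  qed
  from ex_odd_circuit_if_no_green[OF assms this]
  obtain P where P: "P \<in> walks_from g A" "odd_circuit P" by blast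
  note P' = walks_fromD[OF P(1)]
  have hd: "fst (hd P) \<in> A" "fst (hd P) \<in> supp w"
    using P(2) P' walk_mem[OF P'(1), of "fst (hd P)" "snd (hd P)"] by (auto simp: odd_circuit_def)
  have "x = g \<or> x = fst (hd P)" if x: "x \<in> A" "x \<in> supp w" for x
  proof (rule ccontr)
    assume n: "\<not> ?thesis"
    have "x \<notin> fst ` set P"
      using edges_at_start[OF P'(1) _ P'(2) _ x(1)] n P(2) by (auto simp: odd_circuit_def)
    then have 0: "alternating P x = 0" by (rule alternating_outside)
    have "w x < 1" using other_lt_one[OF assms(1,2) x(1) assms(3)] n by blast
    from ex_balanced_off[OF assms(1) x this] obtain u where "balanced_off A u" "u x \<noteq> 0" by blast
    with balanced_off_unique[OF odd_circuit_balanced(1)[OF P(2,1)] _ 0 this(1) assms(1), of g]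
      odd_circuit_balanced(2)[OF P(2,1)] show False by simp
  qed
  then have "A \<inter> supp w = {g, fst (hd P)}" using hd assms by auto
  with P show ?thesis by blast
qed

lemma inter_supp_eq:
  assumes "A \<in> \<Gamma>" "g \<in> A" "h \<in> A" "g \<in> supp w" "h \<in> supp w" "g \<noteq> h"
  shows "A \<inter> supp w = {g, h}"
proof -
  have "w g < 1" using other_lt_one[OF assms(1) assms(3,2,5,6)] .
  from ex_odd_circuit[OF assms(1,2,4) this] obtain k where "A \<inter> supp w = {g, k}" by blast
  with assms show ?thesis by auto
qed

end

section \<open>Odd primitive cycles\<close>

lemma adjacent_sym: "adjacent \<Gamma> g h \<longleftrightarrow> adjacent \<Gamma> h g"
  by (auto simp: adjacent_def)

text \<open>The closing vertex is listed twice: two entries would form a loop, and three would run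
  the same edge forth and back.\<close>

lemma cycle_length_ge:
  assumes "graph_cycle \<Gamma> \<gamma>"
  shows "4 \<le> length \<gamma>"
proof (rule ccontr)
  assume "\<not> 4 \<le> length \<gamma>"
  moreover have \<gamma>: "length \<gamma> > 1" "last \<gamma> = hd \<gamma>" "distinct (path_edges \<gamma>)"
    and adj: "\<And>j. Suc j < length \<gamma> \<Longrightarrow> adjacent \<Gamma> (\<gamma> ! j) (\<gamma> ! Suc j)"
    using assms by (auto simp: graph_cycle_def graph_path_def)
  moreover have eq: "\<gamma> ! (length \<gamma> - 1) = \<gamma> ! 0"
    using \<gamma> by (cases \<gamma>) (auto simp: last_conv_nth hd_conv_nth)
  ultimately consider "length \<gamma> = 2" | "length \<gamma> = 3" by linarith
  then show False
  proof cases
    case 1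
    then show False using adj[of 0] eq by (simp add: adjacent_def)
  next
    case 2
    then have "path_edges \<gamma> = [{\<gamma> ! 0, \<gamma> ! 1}, {\<gamma> ! 1, \<gamma> ! 2}]"
      by (simp add: path_edges_def upt_rec numeral_2_eq_2)
    then show False using \<gamma>(3) eq 2 by (simp add: insert_commute)
  qed
qed

text \<open>Successive edges differ, so the predecessor and the successor of a vertex differ; for
  the closing vertex these are the entries \<open>n - 1\<close> and \<open>1\<close>.\<close>

lemma cycle_two_neighbours:
  assumes "graph_cycle \<Gamma> \<gamma>" "g \<in> set \<gamma>"
  shows "\<exists>h\<in>set \<gamma>. \<exists>k\<in>set \<gamma>. h \<noteq> k \<and> adjacent \<Gamma> g h \<and> adjacent \<Gamma> g k"
proof -
  define n where "n = length \<gamma> - 1"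
  have n: "3 \<le> n" "length \<gamma> = Suc n" using cycle_length_ge[OF assms(1)] by (auto simp: n_def)
  have \<gamma>: "last \<gamma> = hd \<gamma>" "distinct (path_edges \<gamma>)"
    and adj: "\<And>j. j < n \<Longrightarrow> adjacent \<Gamma> (\<gamma> ! j) (\<gamma> ! Suc j)"
    using assms n by (auto simp: graph_cycle_def graph_path_def)
  have eq: "\<gamma> ! n = \<gamma> ! 0"
    using \<gamma>(1) n last_conv_nth[of \<gamma>] hd_conv_nth[of \<gamma>] by fastforce
  have edges: "{\<gamma> ! i, \<gamma> ! Suc i} \<noteq> {\<gamma> ! j, \<gamma> ! Suc j}" if "i < n" "j < n" "i \<noteq> j" for i j
    using \<gamma>(2) that n by (auto simp: path_edges_def distinct_conv_nth)
  obtain j where j: "j < Suc n" "\<gamma> ! j = g" using assms(2) n by (auto simp: in_set_conv_nth)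
  have mem: "i \<le> n \<Longrightarrow> \<gamma> ! i \<in> set \<gamma>" for i using n by auto
  show ?thesis
  proof (cases "j = 0 \<or> j = n")
    case True
    then have g: "\<gamma> ! 0 = g" "\<gamma> ! n = g" using j eq by auto
    have "\<gamma> ! 1 \<noteq> \<gamma> ! (n - 1)" using edges[of 0 "n - 1"] g n by (auto simp: insert_commute)
    moreover have "adjacent \<Gamma> g (\<gamma> ! 1)" using adj[of 0] g n by simp
    moreover have "adjacent \<Gamma> g (\<gamma> ! (n - 1))" using adj[of "n - 1"] g n by (simp add: adjacent_sym)
    ultimately show ?thesis using mem[of 1] mem[of "n - 1"] n by (metis diff_le_self le_trans one_le_numeral)
  next
    case False
    then have j': "0 < j" "j < n" using j by auto
    then have "j - 1 < n" "j - 1 \<noteq> j" "Suc (j - 1) = j" by auto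
    then have "\<gamma> ! (j - 1) \<noteq> \<gamma> ! Suc j" using edges[of "j - 1" j] j' by (auto simp: insert_commute)
    moreover have "adjacent \<Gamma> g (\<gamma> ! Suc j)" using adj[of j] j j' by simp
    moreover have "adjacent \<Gamma> g (\<gamma> ! (j - 1))" using adj[of "j - 1"] j j' by (simp add: adjacent_sym)
    ultimately show ?thesis using mem[of "Suc j"] mem[of "j - 1"] j' by (metis Suc_leI less_imp_diff_less less_imp_le)
  qed
qed

text \<open>Two neighbours of \<open>g\<close> on the cycle lie in different members through
  \<open>g\<close>, since a common one would hold three vertices. By multiplicity two,
  \<open>A\<close> is one of these members.\<close>

lemma odd_primitive_cycle_inter:
  assumes "odd_primitive_cycle \<Gamma> \<gamma>" "g \<in> set \<gamma>" "g \<in> A" "A \<in> \<Gamma>"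
    and at_most_two: "\<And>A B C g. \<lbrakk>A \<in> \<Gamma>; B \<in> \<Gamma>; C \<in> \<Gamma>; g \<in> A; g \<in> B; g \<in> C\<rbrakk> \<Longrightarrow> A = B \<or> A = C \<or> B = C"
  shows "card (A \<inter> set \<gamma>) = 2"
proof -
  have cyc: "graph_cycle \<Gamma> \<gamma>" and prim: "\<And>A. A \<in> \<Gamma> \<Longrightarrow> card (A \<inter> set \<gamma>) \<le> 2"
    using assms(1) by (auto simp: odd_primitive_cycle_def primitive_path_def)
  obtain h k where hk: "h \<in> set \<gamma>" "k \<in> set \<gamma>" "h \<noteq> k" "adjacent \<Gamma> g h" "adjacent \<Gamma> g k"
    using cycle_two_neighbours[OF cyc assms(2)] by blast
  obtain B C where B: "B \<in> \<Gamma>" "g \<in> B" "h \<in> B" "g \<noteq> h" and C: "C \<in> \<Gamma>" "g \<in> C" "k \<in> C" "g \<noteq> k"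
    using hk(4,5) by (auto simp: adjacent_def)
  have "B \<noteq> C"
  proof
    assume "B = C"
    then have "{g, h, k} \<subseteq> B \<inter> set \<gamma>" using B C hk assms(2) by auto
    then have "card {g, h, k} \<le> card (B \<inter> set \<gamma>)" by (intro card_mono) auto
    with prim[OF B(1)] hk B C show False by simp
  qed
  then have "A = B \<or> A = C" using at_most_two[OF B(1) C(1) assms(4) B(2) C(2) assms(3)] by auto
  then obtain x where "x \<in> A \<inter> set \<gamma>" "x \<noteq> g" using B C hk by auto
  then have "card {g, x} \<le> card (A \<inter> set \<gamma>)" using assms by (intro card_mono) auto
  with prim[OF assms(4)] \<open>x \<noteq> g\<close> show ?thesis by simp
qed

lemma odd_primitive_cycle_card_neighbours:
  assumes "odd_primitive_cycle \<Gamma> \<gamma>" "g \<in> set \<gamma>"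
  shows "card {h \<in> set \<gamma>. adjacent \<Gamma> g h} = 2"
proof -
  have cyc: "graph_cycle \<Gamma> \<gamma>" and le: "card {h \<in> set \<gamma>. adjacent \<Gamma> g h} \<le> 2"
    using assms by (auto simp: odd_primitive_cycle_def primitive_path_def simple_graph_path_def)
  obtain h k where hk: "h \<in> set \<gamma>" "k \<in> set \<gamma>" "h \<noteq> k" "adjacent \<Gamma> g h" "adjacent \<Gamma> g k"
    using cycle_two_neighbours[OF cyc assms(2)] by blast
  then have "card {h, k} \<le> card {h \<in> set \<gamma>. adjacent \<Gamma> g h}" by (intro card_mono) auto
  with hk le show ?thesis by simp
qed

text \<open>The points where \<open>u > 1/2\<close> and those where \<open>u < 1/2\<close> span a 2-regular bipartite graph, so
  there are equally many of them. On an odd cycle some value must therefore equal \<open>1/2\<close>, and this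
  value propagates along the cycle.\<close>

lemma odd_primitive_cycle_half:
  fixes u :: "'a \<Rightarrow> real"
  assumes "odd_primitive_cycle \<Gamma> \<gamma>"
    and sum: "\<And>g h. \<lbrakk>g \<in> set \<gamma>; h \<in> set \<gamma>; adjacent \<Gamma> g h\<rbrakk> \<Longrightarrow> u g + u h = 1"
    and "g \<in> set \<gamma>"
  shows "u g = 1/2"
proof -
  let ?S = "set \<gamma>"
  let ?X = "{x \<in> ?S. u x > 1/2}" and ?Y = "{x \<in> ?S. u x < 1/2}" and ?Z = "{x \<in> ?S. u x = 1/2}"
  have "card {y \<in> ?Y. adjacent \<Gamma> x y} = 2" if "x \<in> ?X" for x
  proof -
    have "{y \<in> ?Y. adjacent \<Gamma> x y} = {y \<in> ?S. adjacent \<Gamma> x y}" using sum[of x] that by fastforce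
    then show ?thesis using odd_primitive_cycle_card_neighbours[OF assms(1)] that by simp
  qed
  then have "(\<Sum>x\<in>?X. card {y \<in> ?Y. adjacent \<Gamma> x y}) = 2 * card ?X" by simp
  moreover have "card {x \<in> ?X. adjacent \<Gamma> x y} = 2" if "y \<in> ?Y" for y
  proof -
    have "x \<in> {x \<in> ?X. adjacent \<Gamma> x y} \<longleftrightarrow> x \<in> {x \<in> ?S. adjacent \<Gamma> y x}" for x
      using sum[of y x] that adjacent_sym[of \<Gamma> x y] by auto
    then have "{x \<in> ?X. adjacent \<Gamma> x y} = {x \<in> ?S. adjacent \<Gamma> y x}" by (rule set_eqI)
    then show ?thesis using odd_primitive_cycle_card_neighbours[OF assms(1)] that by simp
  qed
  then have "(\<Sum>x\<in>?X. card {y \<in> ?Y. adjacent \<Gamma> x y}) = 2 * card ?Y"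
    by (intro sum_multicount) auto
  ultimately have XY: "card ?X = card ?Y" by simp
  have "?S = (?X \<union> ?Y) \<union> ?Z" by auto
  moreover have "card ((?X \<union> ?Y) \<union> ?Z) = card ?X + card ?Y + card ?Z"
    by (subst card_Un_disjoint; force?) (subst card_Un_disjoint; force?)
  ultimately have "card ?S = 2 * card ?X + card ?Z" using XY by simp
  moreover have "odd (card ?S)" using assms(1) by (simp add: odd_primitive_cycle_def odd_path_def)
  ultimately have "?Z \<noteq> {}" by (metis card.empty add.right_neutral even_mult_iff even_numeral)
  then obtain i where i: "i < length \<gamma>" "u (\<gamma> ! i) = 1/2" by (auto simp: in_set_conv_nth)
  have adj: "adjacent \<Gamma> (\<gamma> ! j) (\<gamma> ! Suc j)" if "Suc j < length \<gamma>" for j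
    using assms(1) that by (auto simp: odd_primitive_cycle_def graph_cycle_def graph_path_def)
  have step: "u (\<gamma> ! j) = 1/2 \<longleftrightarrow> u (\<gamma> ! Suc j) = 1/2" if "Suc j < length \<gamma>" for j
    using sum[OF _ _ adj[OF that]] that by auto
  have all: "u (\<gamma> ! j) = 1/2 \<longleftrightarrow> u (\<gamma> ! 0) = 1/2" if "j < length \<gamma>" for j
    using that by (induction j) (use step in auto)
  show ?thesis using all i assms(3) by (auto simp: in_set_conv_nth)
qed

text \<open>The prepended edge joins the indices \<open>n - 1\<close> and \<open>0\<close> of
  \<open>xs\<close>, which are not consecutive when there are at least three entries; every other
  edge joins consecutive indices.\<close>

lemma distinct_path_edges_closed:
  assumes "distinct xs" "3 \<le> length xs"
  shows "distinct (path_edges (last xs # xs))"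
proof -
  define \<gamma> where "\<gamma> = last xs # xs"
  define n where "n = length xs"
  have n: "3 \<le> n" "length \<gamma> = Suc n" using assms by (auto simp: \<gamma>_def n_def)
  have nth0: "\<gamma> ! 0 = xs ! (n - 1)" using assms n_def by (cases xs) (auto simp: \<gamma>_def last_conv_nth)
  have nthS: "\<gamma> ! Suc j = xs ! j" for j by (simp add: \<gamma>_def)
  have inj: "xs ! i = xs ! j \<longleftrightarrow> i = j" if "i < n" "j < n" for i j
    using assms(1) that nth_eq_iff_index_eq n_def by blast
  have "{\<gamma> ! i, \<gamma> ! Suc i} \<noteq> {\<gamma> ! j, \<gamma> ! Suc j}" if "i < j" "j < n" for i j
  proof -
    obtain j' where j': "j = Suc j'" using gr0_implies_Suc[of j] \<open>i < j\<close> by auto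
    show ?thesis
    proof (cases i)
      case 0
      show ?thesis
        using that n inj[of "n - 1" j'] inj[of "n - 1" j] inj[of 0 j'] inj[of 0 j] inj[of 0 "n - 1"]
        unfolding j' 0 nth0 nthS doubleton_eq_iff by auto
    next
      case (Suc i')
      show ?thesis
        using that n inj[of i' j'] inj[of i j'] inj[of i j] inj[of i' j]
        unfolding j' Suc nthS doubleton_eq_iff by auto
    qed
  qed
  then have "{\<gamma> ! i, \<gamma> ! Suc i} \<noteq> {\<gamma> ! j, \<gamma> ! Suc j}" if "i \<noteq> j" "i < n" "j < n" for i j
    using that by (metis linorder_neq_iff)
  then show ?thesis
    unfolding \<gamma>_def[symmetric] using n by (simp add: path_edges_def distinct_conv_nth)
qed

section \<open>Components of induced subgraphs\<close>

lemma graph_component_unique: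
  assumes "C \<in> graph_components \<Gamma> V" "g \<in> C"
  shows "C = (Restr {(x, y). adjacent \<Gamma> x y} V)\<^sup>* `` {g}" "g \<in> V"
proof -
  let ?R = "Restr {(x, y). adjacent \<Gamma> x y} V"
  have sym: "sym (?R\<^sup>*)" by (rule sym_rtrancl) (auto simp: sym_def adjacent_def)
  from assms obtain x where x: "x \<in> V" "C = ?R\<^sup>* `` {x}" by (auto simp: graph_components_def quotient_def)
  then have xg: "(x, g) \<in> ?R\<^sup>*" using assms by auto
  then have gx: "(g, x) \<in> ?R\<^sup>*" using sym by (auto dest: symD)
  show "C = ?R\<^sup>* `` {g}" using xg gx x by (auto intro: rtrancl_trans)
  from xg x show "g \<in> V" by (induction rule: rtrancl_induct) auto
qed

lemma ex_graph_component: "g \<in> V \<Longrightarrow> \<exists>C\<in>graph_components \<Gamma> V. g \<in> C"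
  by (auto simp: graph_components_def quotient_def)

lemma graph_component_subset: "C \<in> graph_components \<Gamma> V \<Longrightarrow> C \<subseteq> V"
  using graph_component_unique(2) by fast

lemma graph_component_closed:
  assumes "C \<in> graph_components \<Gamma> V" "g \<in> C" "h \<in> V" "adjacent \<Gamma> g h"
  shows "h \<in> C"
  using graph_component_unique[OF assms(1,2)] assms(3,4) by (auto intro: r_into_rtrancl)

text \<open>The points of \<open>V\<close> in one member are pairwise adjacent, so they lie in a
  single component.\<close>

lemma graph_component_inter:
  assumes "C \<in> graph_components \<Gamma> V" "g \<in> C" "A \<in> \<Gamma>" "g \<in> A"
  shows "A \<inter> V = A \<inter> C"
proof -
  have "h \<in> C" if "h \<in> A" "h \<in> V" for h
    using graph_component_closed[OF assms(1,2) that(2)] assms that by (cases "g = h") (auto simp: adjacent_def)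
  then show ?thesis using graph_component_subset[OF assms(1)] by auto
qed

section \<open>The support of a rigid weighting\<close>

context rigid_weighting
begin

text \<open>A member shared by \<open>g\<close> and a neighbour \<open>h\<close> meets the support
  in exactly \<open>{g, h}\<close>, so the neighbours inject into the members through
  \<open>g\<close>.\<close>

lemma card_neighbours_le_two:
  assumes "g \<in> supp w"
  shows "finite {h \<in> supp w. adjacent \<Gamma> g h} \<and> card {h \<in> supp w. adjacent \<Gamma> g h} \<le> 2"
proof -
  let ?N = "{B \<in> \<Gamma>. g \<in> B}" and ?H = "{h \<in> supp w. adjacent \<Gamma> g h}"
  have "\<exists>B C. ?N \<subseteq> {B, C}"
  proof (cases "\<exists>B\<in>?N. \<exists>C\<in>?N. B \<noteq> C")
    case True
    then obtain B C where "B \<in> ?N" "C \<in> ?N" "B \<noteq> C" by blast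
    then have "?N \<subseteq> {B, C}" using at_most_two by blast
    then show ?thesis by blast
  next
    case False
    show ?thesis
    proof (cases "?N = {}")
      case True
      show ?thesis unfolding True by blast
    next
      case nonempty: False
      then obtain B where "B \<in> ?N" by blast
      with False have "?N \<subseteq> {B, B}" by blast
      then show ?thesis by blast
    qed
  qed
  then obtain B C where N: "?N \<subseteq> {B, C}" by blast
  have "card {B, C} \<le> 2" by (simp add: card_insert_if)
  then have N2: "finite ?N" "card ?N \<le> 2"
    using finite_subset[OF N] card_mono[OF _ N] by simp_all
  define f where "f h = (SOME B. B \<in> \<Gamma> \<and> g \<in> B \<and> h \<in> B)" for h
  have f: "f h \<in> \<Gamma>" "g \<in> f h" "h \<in> f h" "g \<noteq> h" if "h \<in> ?H" for h
  proof -
    have "\<exists>B. B \<in> \<Gamma> \<and> g \<in> B \<and> h \<in> B" using that by (auto simp: adjacent_def)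
    from someI_ex[OF this] show "f h \<in> \<Gamma>" "g \<in> f h" "h \<in> f h" by (auto simp: f_def)
    show "g \<noteq> h" using that by (auto simp: adjacent_def)
  qed
  have "inj_on f ?H"
  proof
    fix h k assume hk: "h \<in> ?H" "k \<in> ?H" "f h = f k"
    have "{g, h} = {g, k}"
      using inter_supp_eq[OF f(1-3)[OF hk(1)] assms _ f(4)[OF hk(1)]]
        inter_supp_eq[OF f(1-3)[OF hk(2)] assms _ f(4)[OF hk(2)]] hk by simp
    then show "h = k" by (auto simp: doubleton_eq_iff)
  qed
  moreover have "f ` ?H \<subseteq> ?N" using f by auto
  ultimately show ?thesis
    using N2 card_inj_on_le[of f ?H ?N] inj_on_finite[of f ?H ?N] by auto
qed

text \<open>The edges of the circuit become the vertices of the cycle. The first edge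
  \<open>g\<close> stands at the end of the list, so prepending it closes the sequence.\<close>

lemma odd_circuit_cycle:
  assumes "odd_circuit P" "P \<in> walks_from g A"
  shows "odd_primitive_cycle \<Gamma> (g # map fst P)" "set (g # map fst P) = fst ` set P"
proof -
  let ?\<gamma> = "g # map fst P"
  note P = walks_fromD[OF assms(2)] and c = assms(1)[unfolded odd_circuit_def]
  have last: "last (map fst P) = g" using P(2,3) by (simp add: last_map)
  then have "g \<in> set (map fst P)" using P(3) by (metis last_in_set map_is_Nil_conv)
  then show set: "set ?\<gamma> = fst ` set P" by auto
  have d: "distinct (map fst P)" using distinct_nodes_imp_distinct_edges c by blast
  have len: "3 \<le> length (map fst P)" using c by (cases "length P = 2") auto
  have supp: "fst ` set P \<subseteq> supp w" using walk_mem[OF P(1)] by auto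
  have step: "adjacent \<Gamma> (map fst Q ! j) (map fst Q ! Suc j)" if "walk Q" "Suc j < length Q" for Q j
    using that
  proof (induction Q arbitrary: j rule: walk.induct)
    case (3 x B h C Q)
    then show ?case
      using walk_head[of h C Q] by (cases j) (auto simp: adjacent_def)
  qed auto
  have k: "fst (hd P) \<in> A" "g \<noteq> fst (hd P)"
  proof -
    show "fst (hd P) \<in> A" using c P(2) by simp
    obtain x Q where PQ: "P = x # Q" "Q \<noteq> []" using c by (cases P; cases "tl P") auto
    then have "(g, A) \<in> set Q" using P(2) by (metis last.simps last_in_set)
    then have "g \<in> fst ` set Q" by (rule rev_image_eqI) simp
    moreover have "fst x \<notin> fst ` set Q" using d PQ by simp
    ultimately show "g \<noteq> fst (hd P)" using PQ(1) by (metis list.sel(1))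
  qed
  have adj: "adjacent \<Gamma> (?\<gamma> ! j) (?\<gamma> ! Suc j)" if "Suc j < length ?\<gamma>" for j
  proof (cases j)
    case 0
    have "map fst P ! 0 = fst (hd P)" using P(3) by (simp add: hd_conv_nth)
    then show ?thesis using 0 k P(5,6) by (auto simp: adjacent_def)
  next
    case (Suc i)
    then show ?thesis using step[OF P(1), of i] that by simp
  qed
  have "fst ` set P \<subseteq> \<Union>\<Gamma>" using walk_mem[OF P(1)] by fastforce
  then have path: "graph_path \<Gamma> ?\<gamma>"
    unfolding graph_path_def using set adj distinct_path_edges_closed[OF d len] last by auto
  have "last ?\<gamma> = g" using last P(3) by simp
  then have cycle: "graph_cycle \<Gamma> ?\<gamma>" unfolding graph_cycle_def using path P(3) by simp
  have "card {h \<in> set ?\<gamma>. adjacent \<Gamma> x h} \<le> 2" if "x \<in> set ?\<gamma>" for x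
  proof -
    have x: "x \<in> supp w" using that set supp by auto
    have "{h \<in> set ?\<gamma>. adjacent \<Gamma> x h} \<subseteq> {h \<in> supp w. adjacent \<Gamma> x h}" using set supp by auto
    with card_neighbours_le_two[OF x] show ?thesis using card_mono le_trans by meson
  qed
  moreover have "card (B \<inter> set ?\<gamma>) \<le> 2" if B: "B \<in> \<Gamma>" for B
  proof (cases "\<exists>x\<in>B \<inter> set ?\<gamma>. \<exists>y\<in>B \<inter> set ?\<gamma>. x \<noteq> y")
    case True
    then obtain x y where xy: "x \<in> B \<inter> set ?\<gamma>" "y \<in> B \<inter> set ?\<gamma>" "x \<noteq> y" by blast
    then have "B \<inter> supp w = {x, y}" using inter_supp_eq[OF B, of x y] set supp by auto
    then have "B \<inter> set ?\<gamma> \<subseteq> {x, y}" using set supp by auto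
    then have "card (B \<inter> set ?\<gamma>) \<le> card {x, y}" by (rule card_mono[rotated]) simp
    then show ?thesis using xy by simp
  next
    case False
    then have "\<forall>x\<in>B \<inter> set ?\<gamma>. \<forall>y\<in>B \<inter> set ?\<gamma>. x = y" by blast
    moreover have "finite (B \<inter> set ?\<gamma>)" by blast
    ultimately have "card (B \<inter> set ?\<gamma>) \<le> Suc 0" using card_le_Suc0_iff_eq by blast
    then show ?thesis by linarith
  qed
  moreover have "card (set ?\<gamma>) = length P" unfolding set using d distinct_card[of "map fst P"] by simp
  then have "odd (card (set ?\<gamma>))" using c by presburger
  ultimately show "odd_primitive_cycle \<Gamma> ?\<gamma>"
    unfolding odd_primitive_cycle_def primitive_path_def simple_graph_path_def odd_path_def
    using path cycle by blast
qed

lemma walk_connected: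
  "walk P \<Longrightarrow> x \<in> fst ` set P \<Longrightarrow> (fst (last P), x) \<in> (Restr {(x, y). adjacent \<Gamma> x y} (supp w))\<^sup>*"
proof (induction P arbitrary: x rule: walk.induct)
  case (3 g A h B P)
  let ?R = "Restr {(x, y). adjacent \<Gamma> x y} (supp w)"
  have h: "(fst (last ((h, B) # P)), h) \<in> ?R\<^sup>*" using 3 by simp
  have "(h, g) \<in> ?R" using 3 walk_head[of h B P] by (auto simp: adjacent_def)
  with h have g: "(fst (last ((h, B) # P)), g) \<in> ?R\<^sup>*" by (rule rtrancl_into_rtrancl)
  show ?case
  proof (cases "x = g")
    case True
    then show ?thesis using g by simp
  next
    case False
    then have "(fst (last ((h, B) # P)), x) \<in> ?R\<^sup>*" using 3 by auto
    then show ?thesis by simp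
  qed
qed auto

text \<open>The cycle through \<open>g\<close> exhausts the component: a member joining a vertex
  \<open>x\<close> of it to a support point \<open>y\<close> meets the support only in
  \<open>{x, y}\<close> but the cycle in two points, so \<open>y\<close> is on the cycle.\<close>

lemma component_odd_primitive_cycle:
  assumes "C \<in> graph_components \<Gamma> (supp w)" "g \<in> C" "A \<in> \<Gamma>" "g \<in> A" "w g < 1"
  shows "\<exists>\<gamma>. odd_primitive_cycle \<Gamma> \<gamma> \<and> C = set \<gamma>"
proof -
  let ?R = "Restr {(x, y). adjacent \<Gamma> x y} (supp w)"
  note C = graph_component_unique[OF assms(1,2)]
  obtain P where P: "P \<in> walks_from g A" "odd_circuit P" using ex_odd_circuit[OF assms(3,4) C(2) assms(5)] by blast
  note P' = walks_fromD[OF P(1)]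
  let ?\<gamma> = "g # map fst P"
  note cyc = odd_circuit_cycle[OF P(2,1)]
  have supp: "set ?\<gamma> \<subseteq> supp w" unfolding cyc(2) using walk_mem[OF P'(1)] by auto
  have "y \<in> set ?\<gamma>" if "(g, y) \<in> ?R\<^sup>*" for y
    using that
  proof (induction rule: rtrancl_induct)
    case (step x y)
    then obtain B where B: "B \<in> \<Gamma>" "x \<in> B" "y \<in> B" "x \<noteq> y" "x \<in> supp w" "y \<in> supp w"
      by (auto simp: adjacent_def)
    have "B \<inter> set ?\<gamma> \<subseteq> {x, y}" using inter_supp_eq[OF B(1-3,5,6,4)] supp by auto
    moreover have "card (B \<inter> set ?\<gamma>) = 2"
      by (rule odd_primitive_cycle_inter[OF cyc(1) step.IH B(2,1) at_most_two])
    ultimately have "B \<inter> set ?\<gamma> = {x, y}" using B(4) by (intro card_subset_eq) auto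
    then show ?case by blast
  qed simp
  then have "C \<subseteq> set ?\<gamma>" unfolding C(1) by auto
  moreover have "set ?\<gamma> \<subseteq> C" unfolding cyc(2) C(1) using walk_connected[OF P'(1)] P'(2) by auto
  ultimately show ?thesis using cyc(1) by blast
qed

end

section \<open>Extreme points\<close>

text \<open>Greedy colouring: at most two neighbours block at most two of the three colours.\<close>

lemma ex_three_colouring:
  assumes "finite V" "\<And>x y. E x y \<Longrightarrow> E y x" "\<And>x. \<not> E x x"
    and "\<And>x. x \<in> V \<Longrightarrow> card {y \<in> V. E x y} \<le> 2"
  shows "\<exists>c :: 'a \<Rightarrow> nat. \<forall>x\<in>V. c x < 3 \<and> (\<forall>y\<in>V. E x y \<longrightarrow> c x \<noteq> c y)"
  using assms(1,4)
proof (induction V)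
  case (insert x F)
  have "card {z \<in> F. E y z} \<le> 2" if "y \<in> F" for y
  proof -
    have "card {z \<in> F. E y z} \<le> card {z \<in> insert x F. E y z}"
      using insert.hyps by (intro card_mono) auto
    then show ?thesis using insert.prems[of y] that by simp
  qed
  then obtain c :: "'a \<Rightarrow> nat" where c: "\<forall>y\<in>F. c y < 3 \<and> (\<forall>z\<in>F. E y z \<longrightarrow> c y \<noteq> c z)"
    using insert.IH by blast
  let ?N = "{y \<in> F. E x y}"
  have "card ?N \<le> card {y \<in> insert x F. E x y}" using insert.hyps by (intro card_mono) auto
  then have "card (c ` ?N) \<le> 2"
    using insert.prems[of x] card_image_le[of ?N c] insert.hyps by simp
  then have "\<not> {..<3} \<subseteq> c ` ?N"
    using card_mono[of "c ` ?N" "{..<3}"] insert.hyps by auto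
  then obtain k where k: "k < 3" "k \<notin> c ` ?N" by auto
  have "(c(x := k)) y < 3 \<and> (\<forall>z\<in>insert x F. E y z \<longrightarrow> (c(x := k)) y \<noteq> (c(x := k)) z)"
    if y: "y \<in> insert x F" for y
  proof (cases "y = x")
    case True
    have "k \<noteq> c z" if "z \<in> F" "E x z" for z using k(2) that by blast
    then show ?thesis using True k(1) assms(3) insert.hyps(2) by simp
  next
    case False
    then have yF: "y \<in> F" using y by simp
    have "E y x \<Longrightarrow> c y \<noteq> k" using k(2) assms(2)[of y x] yF by blast
    then show ?thesis using c yF False by simp
  qed
  then show ?case by blast
qed simp

lemma independent_indicator_zero_one_substochastic:
  assumes "I \<subseteq> \<Union>\<Gamma>" "\<And>g h. \<lbrakk>g \<in> I; h \<in> I\<rbrakk> \<Longrightarrow> \<not> adjacent \<Gamma> g h"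
  shows "(\<lambda>x. if x \<in> I then 1 else 0) \<in> zero_one_substochastic \<Gamma>"
proof -
  let ?f = "\<lambda>x. if x \<in> I then 1 else (0::real)"
  have "?f summable_on A \<and> infsum ?f A \<le> 1" if A: "A \<in> \<Gamma>" for A
  proof -
    have le: "card (A \<inter> I) \<le> 1" and fin: "finite (A \<inter> I)"
    proof -
      have "g = h" if "g \<in> A \<inter> I" "h \<in> A \<inter> I" for g h
        using assms(2)[of g h] A that by (auto simp: adjacent_def)
      then obtain g where g: "A \<inter> I \<subseteq> {g}" by (metis subsetI singletonI)
      show "finite (A \<inter> I)" using finite_subset[OF g] by simp
      show "card (A \<inter> I) \<le> 1" using card_mono[OF _ g] by simp
    qed
    have "(?f has_sum (\<Sum>x\<in>A \<inter> I. ?f x)) A"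
      by (rule has_sum_finite_neutralI[OF fin]) auto
    moreover have "(\<Sum>x\<in>A \<inter> I. ?f x) = card (A \<inter> I)" by simp
    ultimately show ?thesis using le by (auto simp: summable_on_def dest: infsumI)
  qed
  then show ?thesis
    using assms(1) by (auto simp: zero_one_substochastic_def substochastic_def fun_on_def)
qed

text \<open>The support may be infinite, so the greedy colouring is applied to each finite component
  and the colourings are glued. Each colour class is independent, hence its indicator lies in
  \<open>W\<close>.\<close>

lemma admissible_space_mem:
  assumes W: "admissible_space \<Gamma> W" and w: "w \<in> fun_on (\<Union>\<Gamma>)" "\<And>g. 0 \<le> w g" "\<And>g. w g \<le> 1"
    and comps: "\<And>C. C \<in> graph_components \<Gamma> (supp w) \<Longrightarrow>
      (\<exists>g. C = {g}) \<or> (\<exists>\<gamma>. odd_primitive_cycle \<Gamma> \<gamma> \<and> C = set \<gamma>)"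
  shows "w \<in> W"
proof -
  let ?V = "supp w" and ?R = "Restr {(x, y). adjacent \<Gamma> x y} (supp w)"
  have "\<exists>c :: 'a \<Rightarrow> nat. \<forall>x\<in>C. c x < 3 \<and> (\<forall>y\<in>C. adjacent \<Gamma> x y \<longrightarrow> c x \<noteq> c y)"
    if C: "C \<in> graph_components \<Gamma> ?V" for C
  proof (rule ex_three_colouring)
    from comps[OF C] show "finite C" by auto
    show "adjacent \<Gamma> x y \<Longrightarrow> adjacent \<Gamma> y x" for x y by (simp add: adjacent_sym)
    show "\<not> adjacent \<Gamma> x x" for x by (simp add: adjacent_def)
    show "card {y \<in> C. adjacent \<Gamma> x y} \<le> 2" if x: "x \<in> C" for x
      using comps[OF C]
    proof
      assume "\<exists>g. C = {g}"
      with x have "{y \<in> C. adjacent \<Gamma> x y} = {}" by (auto simp: adjacent_def)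
      then show ?thesis by (metis card.empty zero_le)
    next
      assume "\<exists>\<gamma>. odd_primitive_cycle \<Gamma> \<gamma> \<and> C = set \<gamma>"
      with x odd_primitive_cycle_card_neighbours[of \<Gamma> _ x] show ?thesis by auto
    qed
  qed
  then obtain c :: "'a set \<Rightarrow> 'a \<Rightarrow> nat" where
    c: "\<And>C x. C \<in> graph_components \<Gamma> ?V \<Longrightarrow> x \<in> C \<Longrightarrow> c C x < 3"
      "\<And>C x y. C \<in> graph_components \<Gamma> ?V \<Longrightarrow> x \<in> C \<Longrightarrow> y \<in> C \<Longrightarrow> adjacent \<Gamma> x y \<Longrightarrow> c C x \<noteq> c C y"
    by metis
  define col where "col x = c (?R\<^sup>* `` {x}) x" for x
  have col: "col x < 3" if x: "x \<in> ?V" for x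
  proof -
    from ex_graph_component[OF x] obtain C where C: "C \<in> graph_components \<Gamma> ?V" "x \<in> C" by blast
    then show ?thesis using c(1)[OF C] graph_component_unique(1)[OF C] by (simp add: col_def)
  qed
  have col_ne: "col x \<noteq> col y" if x: "x \<in> ?V" and y: "y \<in> ?V" and xy: "adjacent \<Gamma> x y" for x y
  proof -
    from ex_graph_component[OF x] obtain C where C: "C \<in> graph_components \<Gamma> ?V" "x \<in> C" by blast
    have yC: "y \<in> C" using graph_component_closed[OF C y xy] .
    show ?thesis
      using c(2)[OF C yC xy] graph_component_unique(1)[OF C] graph_component_unique(1)[OF C(1) yC]
      by (simp add: col_def)
  qed
  define f where "f i = (\<lambda>x. if x \<in> {x \<in> ?V. col x = i} then 1 else (0::real))" for i
  have "?V \<subseteq> \<Union>\<Gamma>" using w(1) by (auto simp: supp_def fun_on_def)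
  then have "f i \<in> zero_one_substochastic \<Gamma>" for i
    unfolding f_def
  proof (intro independent_indicator_zero_one_substochastic)
    show "\<not> adjacent \<Gamma> g h" if "g \<in> {x \<in> ?V. col x = i}" "h \<in> {x \<in> ?V. col x = i}" for g h
    proof
      assume "adjacent \<Gamma> g h"
      with col_ne[of g h] that show False by simp
    qed
  qed (use \<open>?V \<subseteq> \<Union>\<Gamma>\<close> in auto)
  then have "f i \<in> W" for i using W by (auto simp: admissible_space_def)
  then have sum: "f 0 + f 1 + f 2 \<in> W"
    using W by (auto simp: admissible_space_def intro!: subspace_add)
  have "\<bar>w g\<bar> \<le> \<bar>(f 0 + f 1 + f 2) g\<bar>" for g
  proof (cases "g \<in> ?V")
    case True
    then have "col g = 0 \<or> col g = 1 \<or> col g = 2" using col[OF True] by auto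
    then show ?thesis using True w(2,3)[of g] by (auto simp: f_def)
  next
    case False
    then show ?thesis by (simp add: supp_def)
  qed
  then show ?thesis using W sum w(1) unfolding admissible_space_def by blast
qed

text \<open>Here \<open>V\<close> need not be the support of \<open>u\<close>: besides
  \<open>w\<close>, the result is applied to the ends of a segment through \<open>w\<close>, which
  are only known to vanish off \<open>supp w\<close>.\<close>

lemma component_values_determined:
  fixes u :: "'a \<Rightarrow> real"
  assumes at_most_two: "\<And>A B C g. \<lbrakk>A \<in> \<Gamma>; B \<in> \<Gamma>; C \<in> \<Gamma>; g \<in> A; g \<in> B; g \<in> C\<rbrakk> \<Longrightarrow> A = B \<or> A = C \<or> B = C"
    and sum: "\<And>A. A \<in> \<Gamma> \<Longrightarrow> (u has_sum 1) A" and V: "V \<subseteq> \<Union>\<Gamma>" "\<And>g. g \<notin> V \<Longrightarrow> u g = 0"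
    and C: "C \<in> graph_components \<Gamma> V"
  shows "C = {g} \<Longrightarrow> u g = 1"
    and "odd_primitive_cycle \<Gamma> \<gamma> \<Longrightarrow> C = set \<gamma> \<Longrightarrow> g \<in> set \<gamma> \<Longrightarrow> u g = 1/2"
proof -
  have *: "sum u (A \<inter> C) = 1" if "A \<in> \<Gamma>" "g \<in> A" "g \<in> C" "finite (A \<inter> C)" for A g
  proof -
    have "(u has_sum sum u (A \<inter> C)) A"
      by (rule has_sum_finite_neutralI[OF that(4)])
         (use V(2) graph_component_inter[OF C that(3,1,2)] in auto)
    then show ?thesis using sum[OF that(1)] has_sum_unique by blast
  qed
  {
    assume g: "C = {g}"
    then obtain A where A: "A \<in> \<Gamma>" "g \<in> A" using graph_component_subset[OF C] V(1) by auto
    then have "A \<inter> C = {g}" using g by auto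
    then show "u g = 1" using *[OF A] g by simp
  }
  assume \<gamma>: "odd_primitive_cycle \<Gamma> \<gamma>" "C = set \<gamma>" "g \<in> set \<gamma>"
  have "u g + u h = 1" if gh: "g \<in> set \<gamma>" "h \<in> set \<gamma>" "adjacent \<Gamma> g h" for g h
  proof -
    obtain A where A: "A \<in> \<Gamma>" "g \<in> A" "h \<in> A" "g \<noteq> h" using gh(3) by (auto simp: adjacent_def)
    have "card (A \<inter> C) = 2"
      unfolding \<gamma>(2) by (rule odd_primitive_cycle_inter[OF \<gamma>(1) gh(1) A(2,1) at_most_two])
    then have "{g, h} = A \<inter> C" using A gh \<gamma>(2) by (intro card_subset_eq) auto
    then show ?thesis using *[OF A(1,2)] gh(1) \<gamma>(2) A(4) by (metis List.finite_set finite_Int sum.empty sum.insert add.right_neutral finite.emptyI finite.insertI singletonD empty_iff)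
  qed
  then show "u g = 1/2" by (rule odd_primitive_cycle_half[OF \<gamma>(1) _ \<gamma>(3)])
qed

text \<open>Finiteness enters because \<open>card\<close> is \<open>0\<close> on infinite sets, so
  that \<open>kappa\<close> would not see infinitely many members through \<open>g\<close>.\<close>

lemma kappa_le_two_imp_at_most_two:
  assumes "kappa \<Gamma> \<le> 2" "finite {A \<in> \<Gamma>. g \<in> A}"
    and "A \<in> \<Gamma>" "B \<in> \<Gamma>" "C \<in> \<Gamma>" "g \<in> A" "g \<in> B" "g \<in> C"
  shows "A = B \<or> A = C \<or> B = C"
proof (rule ccontr)
  assume ne: "\<not> ?thesis"
  have "enat (multiplicity_at \<Gamma> g) \<le> kappa \<Gamma>"
    unfolding kappa_def using assms by (intro SUP_upper) auto
  then have "enat (multiplicity_at \<Gamma> g) \<le> enat 2"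
    using assms(1) order_trans by (metis numeral_eq_enat)
  moreover have "card {A, B, C} \<le> multiplicity_at \<Gamma> g"
    unfolding multiplicity_at_def using assms by (intro card_mono) auto
  ultimately show False using ne by simp
qed

text \<open>Moving \<open>w\<close> both ways along a small multiple of a dominated \<open>u\<close>
  with zero sums stays in the set: the sums are unchanged, domination keeps the values nonnegative,
  and both points are at most \<open>2 w\<close>, hence in \<open>W\<close>. Extremality forces
  \<open>u\<close> to vanish.\<close>

lemma extreme_imp_rigid_weighting:
  assumes W: "admissible_space \<Gamma> W"
    and at_most_two: "\<And>A B C g. \<lbrakk>A \<in> \<Gamma>; B \<in> \<Gamma>; C \<in> \<Gamma>; g \<in> A; g \<in> B; g \<in> C\<rbrakk> \<Longrightarrow> A = B \<or> A = C \<or> B = C"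
    and ext: "w \<in> ex (stochastic \<Gamma> \<inter> W)"
  shows "rigid_weighting \<Gamma> w"
proof -
  have ws: "w \<in> stochastic \<Gamma>" "w \<in> W" and
    extr: "\<And>a b. a \<in> stochastic \<Gamma> \<inter> W \<Longrightarrow> b \<in> stochastic \<Gamma> \<inter> W \<Longrightarrow> w \<notin> open_segment a b"
    using ext by (auto simp: ex_def extreme_point_of_def)
  interpret weighting \<Gamma> w
  proof
    show "0 \<le> w g" for g using ws(1) by (simp add: stochastic_def)
    show "(w has_sum 1) A" if "A \<in> \<Gamma>" for A using ws(1) that by (simp add: stochastic_def)
  qed (fact at_most_two)
  have wf: "w \<in> fun_on (\<Union>\<Gamma>)" using ws(1) by (simp add: stochastic_def)
  show ?thesis
  proof unfold_locales
    fix u g assume u: "dominated u" "\<And>A. A \<in> \<Gamma> \<Longrightarrow> (u has_sum 0) A"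
    obtain c where c: "\<And>g. \<bar>u g\<bar> \<le> c * w g" using u(1) by (auto simp: dominated_def)
    \<comment> \<open>The \<open>max\<close> keeps \<open>d\<close> positive for every
      \<open>c\<close> while still ensuring \<open>d * c \<le> 1\<close>.\<close>
    define d where "d = 1 / max c 1"
    have d: "0 < d" "d * c \<le> 1" by (auto simp: d_def divide_simps)
    have du: "\<bar>d * u g\<bar> \<le> w g" for g
    proof -
      have "\<bar>d * u g\<bar> \<le> d * (c * w g)" using c[of g] d(1) by (simp add: abs_mult)
      also have "\<dots> \<le> 1 * w g" using d(2) nonneg[of g] by (metis mult.assoc mult_right_mono)
      finally show ?thesis by simp
    qed
    have mem: "(\<lambda>x. w x + e * (d * u x)) \<in> stochastic \<Gamma> \<inter> W" if e: "\<bar>e\<bar> = 1" for e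
    proof -
      let ?a = "\<lambda>x. w x + e * (d * u x)"
      have bound: "\<bar>e * (d * u x)\<bar> \<le> w x" for x using du[of x] e by (simp add: abs_mult)
      have on: "?a \<in> fun_on (\<Union>\<Gamma>)" unfolding fun_on_def
      proof clarify
        fix x assume "x \<notin> \<Union>\<Gamma>"
        then have "w x = 0" using wf unfolding fun_on_def by blast
        then show "?a x = 0" using bound[of x] by simp
      qed
      have "0 \<le> ?a x" for x using bound[of x] by linarith
      moreover have "(?a has_sum 1) A" if "A \<in> \<Gamma>" for A
        using has_sum_add[OF has_sum_one[OF that] has_sum_cmult_right[OF u(2)[OF that], of "e * d"]]
        by (simp add: mult.assoc)
      ultimately have stoch: "?a \<in> stochastic \<Gamma>" using on by (simp add: stochastic_def)
      have le: "\<bar>?a x\<bar> \<le> \<bar>(2 *\<^sub>R w) x\<bar>" for x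
        using bound[of x] nonneg[of x] by (simp add: abs_le_iff)
      have "2 *\<^sub>R w \<in> W" using W ws(2) by (auto simp: admissible_space_def intro!: subspace_scale)
      then have "\<forall>v\<in>fun_on (\<Union>\<Gamma>). (\<forall>g. \<bar>v g\<bar> \<le> \<bar>(2 *\<^sub>R w) g\<bar>) \<longrightarrow> v \<in> W"
        using W unfolding admissible_space_def by blast
      from bspec[OF this on, THEN mp, OF allI[OF le]] have "?a \<in> W" .
      with stoch show ?thesis by blast
    qed
    let ?a = "\<lambda>x. w x + 1 * (d * u x)" and ?b = "\<lambda>x. w x + (-1) * (d * u x)"
    show "u g = 0"
    proof (rule ccontr)
      assume "u g \<noteq> 0"
      then have "?a g \<noteq> ?b g" using d(1) by simp
      then have "?a \<noteq> ?b" by metis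
      moreover have "w = (1 - 1/2) *\<^sub>R ?a + (1/2) *\<^sub>R ?b"
        by (simp add: fun_eq_iff algebra_simps)
      ultimately have "w \<in> open_segment ?a ?b"
        unfolding in_segment by (intro conjI exI[of _ "1/2"]) auto
      with extr[OF mem mem, of 1 "-1"] show False by simp
    qed
  qed
qed

section \<open>Characterization of the extreme points\<close>

theorem theorem2p11:
  fixes \<Gamma> :: "'a set set" and W :: "('a \<Rightarrow> real) set" and w :: "'a \<Rightarrow> real"
  assumes "countable \<Gamma>"
    and "\<And>A. A \<in> \<Gamma> \<Longrightarrow> countable A"
    and "\<And>A B. A \<in> \<Gamma> \<Longrightarrow> B \<in> \<Gamma> \<Longrightarrow> A \<noteq> B \<Longrightarrow> A - B \<noteq> {}"
    and "\<And>g. g \<in> \<Union>\<Gamma> \<Longrightarrow> finite {A \<in> \<Gamma>. g \<in> A}"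
    and "admissible_space \<Gamma> W"
    and "kappa \<Gamma> \<le> 2"
    and "w \<in> fun_on (\<Union>\<Gamma>)"
  shows "w \<in> ex (stochastic \<Gamma> \<inter> W) \<longleftrightarrow>
    (\<forall>A\<in>\<Gamma>. supp w \<inter> A \<noteq> {}) \<and>
    (\<forall>C\<in>graph_components \<Gamma> (supp w).
       (\<exists>g. C = {g}) \<or> (\<exists>\<gamma>. odd_primitive_cycle \<Gamma> \<gamma> \<and> C = set \<gamma>)) \<and>
    (\<forall>C\<in>graph_components \<Gamma> (supp w).
       (\<forall>g. C = {g} \<longrightarrow> w g = 1) \<and>
       (\<forall>\<gamma>. odd_primitive_cycle \<Gamma> \<gamma> \<and> C = set \<gamma> \<longrightarrow> (\<forall>g\<in>set \<gamma>. w g = 1/2)))"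
    (is "?ext \<longleftrightarrow> ?meets \<and> ?comps \<and> ?vals")
proof -
  have two: "A = B \<or> A = C \<or> B = C"
    if "A \<in> \<Gamma>" "B \<in> \<Gamma>" "C \<in> \<Gamma>" "g \<in> A" "g \<in> B" "g \<in> C" for A B C g
    by (rule kappa_le_two_imp_at_most_two[OF assms(6) assms(4)]) (use that in auto)
  have V: "supp w \<subseteq> \<Union>\<Gamma>" using assms(7) by (auto simp: supp_def fun_on_def)
  have V0: "g \<notin> supp w \<Longrightarrow> w g = 0" for g by (simp add: supp_def)
  have value_one: "u g = 1"
    if u: "\<And>A. A \<in> \<Gamma> \<Longrightarrow> (u has_sum 1) A" "\<And>x. x \<notin> supp w \<Longrightarrow> u x = 0"
      and C: "{g} \<in> graph_components \<Gamma> (supp w)" for u :: "'a \<Rightarrow> real" and g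
    by (rule component_values_determined(1)[OF two u(1) V u(2) C refl])
  have value_half: "u g = 1/2"
    if u: "\<And>A. A \<in> \<Gamma> \<Longrightarrow> (u has_sum 1) A" "\<And>x. x \<notin> supp w \<Longrightarrow> u x = 0"
      and C: "set \<gamma> \<in> graph_components \<Gamma> (supp w)" "odd_primitive_cycle \<Gamma> \<gamma>" "g \<in> set \<gamma>"
    for u :: "'a \<Rightarrow> real" and g \<gamma>
    by (rule component_values_determined(2)[OF two u(1) V u(2) C(1,2) refl C(3)])
  show ?thesis
  proof (rule iffI)
    assume ext: ?ext
    interpret rigid_weighting \<Gamma> w
      by (rule extreme_imp_rigid_weighting[OF assms(5) two ext])
    have ?meets
    proof (intro ballI notI)
      fix A assume A: "A \<in> \<Gamma>" "supp w \<inter> A = {}"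
      then have "(w has_sum 0) A" by (intro has_sum_0) (auto simp: supp_def)
      with has_sum_one[OF A(1)] show False using has_sum_unique by fastforce
    qed
    moreover have ?comps
    proof
      fix C assume C: "C \<in> graph_components \<Gamma> (supp w)"
      then obtain g where g: "g \<in> C" by (auto simp: graph_components_def quotient_def)
      note Cg = graph_component_unique[OF C g]
      obtain A where A: "A \<in> \<Gamma>" "g \<in> A" using V Cg(2) by auto
      show "(\<exists>g. C = {g}) \<or> (\<exists>\<gamma>. odd_primitive_cycle \<Gamma> \<gamma> \<and> C = set \<gamma>)"
      proof (cases "w g < 1")
        case True
        then show ?thesis using component_odd_primitive_cycle[OF C g A] by blast
      next
        case False
        \<comment> \<open>A point of weight at least \<open>1\<close> leaves no room for another
          support point in a common member, so it is isolated.\<close>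
        have "h = g" if "(g, h) \<in> (Restr {(x, y). adjacent \<Gamma> x y} (supp w))\<^sup>*" for h
          using that
        proof (induction rule: rtrancl_induct)
          case (step x y)
          then obtain B where B: "B \<in> \<Gamma>" "g \<in> B" "y \<in> B" "g \<noteq> y" "y \<in> supp w"
            by (auto simp: adjacent_def)
          with pair_le_one[OF B(1-4)] pos[OF B(5)] False show ?case by simp
        qed simp
        then have "C = {g}" unfolding Cg(1) by auto
        then show ?thesis by blast
      qed
    qed
    moreover have ?vals
    proof (intro ballI conjI allI impI; (elim conjE)?)
      fix C g assume "C \<in> graph_components \<Gamma> (supp w)" "C = {g}"
      then show "w g = 1" using value_one[of w g, OF has_sum_one V0] by simp
    next
      fix C \<gamma> g assume "C \<in> graph_components \<Gamma> (supp w)" "odd_primitive_cycle \<Gamma> \<gamma>" "C = set \<gamma>" "g \<in> set \<gamma>"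
      then show "w g = 1/2" using value_half[of w \<gamma> g, OF has_sum_one V0] by simp
    qed
    ultimately show "?meets \<and> ?comps \<and> ?vals" by blast
  next
    assume R: "?meets \<and> ?comps \<and> ?vals"
    from R have meets: ?meets by (rule conjunct1)
    from R have R': "?comps \<and> ?vals" by (rule conjunct2)
    from R' have comps: ?comps by (rule conjunct1)
    from R' have vals: ?vals by (rule conjunct2)
    have one: "w g = 1" if "{g} \<in> graph_components \<Gamma> (supp w)" for g
      using bspec[OF vals that] by simp
    have half: "w g = 1/2"
      if "set \<gamma> \<in> graph_components \<Gamma> (supp w)" "odd_primitive_cycle \<Gamma> \<gamma>" "g \<in> set \<gamma>" for g \<gamma>
      using conjunct2[OF bspec[OF vals that(1)]] that(2,3) by simp
    have cases: "{g} \<in> graph_components \<Gamma> (supp w) \<or>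
        (\<exists>\<gamma>. set \<gamma> \<in> graph_components \<Gamma> (supp w) \<and> odd_primitive_cycle \<Gamma> \<gamma> \<and> g \<in> set \<gamma>)"
      if g: "g \<in> supp w" for g
    proof -
      obtain C where C: "C \<in> graph_components \<Gamma> (supp w)" "g \<in> C" using ex_graph_component[OF g] by blast
      from bspec[OF comps C(1)] show ?thesis
      proof
        assume "\<exists>h. C = {h}"
        then have "C = {g}" using C(2) by auto
        then show ?thesis using C(1) by simp
      next
        assume "\<exists>\<gamma>. odd_primitive_cycle \<Gamma> \<gamma> \<and> C = set \<gamma>"
        then obtain \<gamma> where "odd_primitive_cycle \<Gamma> \<gamma>" "C = set \<gamma>" by (elim exE conjE)
        then show ?thesis using C by (intro disjI2 exI[of _ \<gamma>]) simp
      qed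
    qed
    have "w g = 1 \<or> w g = 1/2" if "g \<in> supp w" for g
      using cases[OF that] one[of g] half[of _ g] by (elim disjE exE conjE) simp_all
    then have w01: "0 \<le> w g \<and> w g \<le> 1" for g using V0[of g] by (cases "g \<in> supp w") force+
    have sum: "(w has_sum 1) A" if A: "A \<in> \<Gamma>" for A
    proof -
      obtain g where g: "g \<in> supp w" "g \<in> A" using bspec[OF meets A] by auto
      \<comment> \<open>All support points in \<open>A\<close> belong to the component of
        \<open>g\<close>, which reduces the sum over \<open>A\<close> to a finite one.\<close>
      have "\<exists>C. A \<inter> supp w = A \<inter> C \<and> finite (A \<inter> C) \<and> sum w (A \<inter> C) = 1"
        using cases[OF g(1)]
      proof (elim disjE exE conjE)
        assume C: "{g} \<in> graph_components \<Gamma> (supp w)"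
        have "A \<inter> supp w = A \<inter> {g}" using graph_component_inter[OF C _ A g(2)] by simp
        then show ?thesis using g(2) one[OF C] by (intro exI[of _ "{g}"]) simp
      next
        fix \<gamma> assume C: "set \<gamma> \<in> graph_components \<Gamma> (supp w)" "odd_primitive_cycle \<Gamma> \<gamma>" "g \<in> set \<gamma>"
        have "card (A \<inter> set \<gamma>) = 2"
          by (rule odd_primitive_cycle_inter[OF C(2,3) g(2) A two])
        moreover have "sum w (A \<inter> set \<gamma>) = (\<Sum>x\<in>A \<inter> set \<gamma>. 1/2)"
          by (rule sum.cong) (use half[OF C(1,2)] in auto)
        ultimately have "sum w (A \<inter> set \<gamma>) = 1" by simp
        then show ?thesis
          using graph_component_inter[OF C(1,3) A g(2)] by (intro exI[of _ "set \<gamma>"]) simp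
      qed
      then obtain C where C: "A \<inter> supp w = A \<inter> C" "finite (A \<inter> C)" "sum w (A \<inter> C) = 1"
        by (elim exE conjE)
      show ?thesis
        by (rule has_sum_finite_neutralI[OF C(2)]) (use C V0 in auto)
    qed
    have mem: "w \<in> stochastic \<Gamma> \<inter> W"
    proof
      show "w \<in> stochastic \<Gamma>" using w01 sum assms(7) by (simp add: stochastic_def)
      show "w \<in> W" by (rule admissible_space_mem[OF assms(5,7)]) (use w01 bspec[OF comps] in simp_all)
    qed
    have "w \<notin> open_segment a b" if ab: "a \<in> stochastic \<Gamma> \<inter> W" "b \<in> stochastic \<Gamma> \<inter> W" for a b
    proof
      assume "w \<in> open_segment a b"
      then obtain t where t: "a \<noteq> b" "0 < t" "t < 1" "w = (1 - t) *\<^sub>R a + t *\<^sub>R b"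
        unfolding in_segment by blast
      have eq: "w g = (1 - t) * a g + t * b g" for g using t(4) by simp
      have pos: "0 \<le> a g" "0 \<le> b g" for g using ab by (auto simp: stochastic_def)
      \<comment> \<open>Both ends are nonnegative and enter with positive coefficients, so they
        vanish wherever \<open>w\<close> does. Their values are then forced by the components of
        \<open>supp w\<close>, and they coincide.\<close>
      have zero: "a g = 0 \<and> b g = 0" if "g \<notin> supp w" for g
      proof -
        have "(1 - t) * a g + t * b g = 0" using eq[of g] V0[OF that] by simp
        moreover have "0 \<le> (1 - t) * a g" "0 \<le> t * b g" using pos t by auto
        ultimately have "(1 - t) * a g = 0" "t * b g = 0" by linarith+
        then show ?thesis using t by auto
      qed
      have sums: "(a has_sum 1) A" "(b has_sum 1) A" if "A \<in> \<Gamma>" for A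
        using ab that by (auto simp: stochastic_def)
      have "a g = b g" for g
      proof (cases "g \<in> supp w")
        case True
        show ?thesis
          using cases[OF True]
        proof (elim disjE exE conjE)
          assume g: "{g} \<in> graph_components \<Gamma> (supp w)"
          have "a g = 1" by (rule value_one[OF sums(1) _ g]) (use zero in auto)
          moreover have "b g = 1" by (rule value_one[OF sums(2) _ g]) (use zero in auto)
          ultimately show ?thesis by simp
        next
          fix \<gamma> assume g: "set \<gamma> \<in> graph_components \<Gamma> (supp w)" "odd_primitive_cycle \<Gamma> \<gamma>" "g \<in> set \<gamma>"
          have "a g = 1/2" by (rule value_half[OF sums(1) _ g]) (use zero in auto)
          moreover have "b g = 1/2" by (rule value_half[OF sums(2) _ g]) (use zero in auto)
          ultimately show ?thesis by simp
        qed
      qed (use zero in simp)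
      with t(1) show False by (auto simp: fun_eq_iff)
    qed
    with mem show ?ext by (auto simp: ex_def extreme_point_of_def)
  qed
qed

end
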